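(* Let $\mathcal{G}$, $H$, $\tau$, $K$ be as in the context. If the automorphism $\tau$ and the gradation of $\mathcal{G}$ defined by $H$ are compatible, i.e. $\tau(H)=H$ (equivalently $\tau(\mathcal{G}_m)=\mathcal{G}_m$ for all $m\in\mathbb{Z}$), then the Wakimoto homomorphism $\mathcal{W}_H: A(\mathcal{G},K)\to W(\mathcal{G},K,H)$ is $\tau$-equivariant: $$\tau_W\circ\mathcal{W}_H=\mathcal{W}_H\circ\tau_A .$$
   Context: Summation over repeated indices in opposite positions is understood. Lie algebra data. $\mathcal{G}$ is a finite-dimensional complex simple Lie algebra with invariant scalar product $\langle\ ,\ \rangle$ (a nondegenerate invariant symmetric bilinear form). $H\in\mathcal{G}$ is a diagonalizable element such that $\mathrm{ad}_H$ has integer eigenvalues, giving the $\mathbb{Z}$-gradation $\mathcal{G}=\oplus_m\mathcal{G}_m$, $\mathcal{G}_m=\{X: [H,X]=mX\}$, and $\mathcal{G}=\mathcal{G}_-+\mathcal{G}_0+\mathcal{G}_+$ (negative, zero, positive grades). $\mathcal{G}_0=\oplus_{i\ge 0}\mathcal{G}_0^i$ with $\mathcal{G}_0^0$ the Abelian factor and $\mathcal{G}_0^i$ ($i>0$) the simple factors. $\tau$ is an automorphism of $\mathcal{G}$ of finite order $N$. Bases (available since $\tau(H)=H$). $\{T_a\},\{T^a\}$ are dual bases of $\mathcal{G}$ ($\langle T_a,T^b\rangle=\delta_a^b$) consisting of joint eigenvectors of $\mathrm{ad}_H$ and $\tau$, with $\tau(T_a)=\omega_aT_a$, $\tau(T^a)=\omega^aT^a$.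 $\{L_\alpha\}\subset\mathcal{G}_-$ and $\{U^\alpha\}\subset\mathcal{G}_+$ are dual bases ($\langle L_\alpha,U^\beta\rangle=\delta_\alpha^\beta$) of joint eigenvectors, with $\tau(L_\alpha)=\omega_\alpha L_\alpha$, $\tau(U^\alpha)=\omega^\alpha U^\alpha$; one takes $T_a=L_\alpha$ for $a=\alpha=1,\dots,\dim\mathcal{G}_-$. $\{D^{i,\mu}\},\{D^i_\mu\}$ are dual bases of $\mathcal{G}_0$ with $D^{i,\mu},D^i_\mu\in\mathcal{G}_0^i$; $\{D^k\},\{D_k\}$ are dual bases of $\mathcal{G}_0$ consisting of $\tau$-eigenvectors, $\tau(D^k)=\omega_0^kD^k$, $\tau(D_k)=\omega_{0,k}D_k$. Polynomials. For $q=q^\alpha L_\alpha\in\mathcal{G}_-$ let $\mathcal{R}(e^{-q})=e^{-\mathrm{ad}_q}$ on $\mathcal{G}$. Polynomials in the variables $\{q^\alpha\}$ are defined by $\mathcal{R}(e^{-q})U^\alpha=\mathcal{U}^\alpha_{\ b}(q)T^b$, $\mathcal{R}(e^{-q})L_\alpha=\mathcal{L}_{\alpha,b}(q)T^b$, $\mathcal{R}(e^{-q})D^{i,\mu}=\mathcal{D}^{i,\mu}_a(q)T^a$; $\frac{\partial e^q}{\partial q^\alpha}e^{-q}=\Phi_\alpha^\beta(q)L_\beta$; $\Phi_\alpha^\beta\Psi_\beta^\gamma=\delta_\alpha^\gamma$; and $\Lambda_\alpha(q)=\frac{\partial\Psi_\gamma^\lambda(q)}{\partial q^\alpha}\Phi_\lambda^\rho(q)\,\mathcal{R}(e^{-q})[U^\gamma,L_\rho]=\Lambda_{\alpha,b}(q)T^b$.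 Vertex algebras. Set $\delta(z,w)=\sum_{n\in\mathbb{Z}}w^nz^{-n-1}$; $K$ is a fixed nonzero complex number. $A(\mathcal{G},K)$ is the vertex algebra (on the vacuum Verma module of the affine Lie algebra) generated by currents $J_a(z)=\sum_{n\in\mathbb{Z}}J_a[n]z^{-n-1}$ with $[J_a(z),J_b(w)]=\langle[T_a,T_b],T^c\rangle J_c(w)\delta(z,w)+K\langle T_a,T_b\rangle\partial_w\delta(z,w)$. $W(\mathcal{G},K,H)$ is the vertex algebra generated by fields $p_\alpha(z),q^\alpha(z),\jmath^i_\mu(z)$ (all with expansions $\phi(z)=\sum_{n\in\mathbb{Z}}\phi[n]z^{-n-1}$, the vacuum being annihilated by all modes with $n\ge0$) whose only nonvanishing commutators are $[q^\alpha(z),p_\beta(w)]=\delta^\alpha_\beta\delta(z,w)$ and $[\jmath^i_\mu(z),\jmath^i_\nu(w)]=\langle[D^i_\mu,D^i_\nu],D^{i,\theta}\rangle\jmath^i_\theta(w)\delta(z,w)+K_0^i\langle D^i_\mu,D^i_\nu\rangle\partial_w\delta(z,w)$, where $2K_0^0=2K+|\psi|^2h^\vee=2K_0^i+|\psi_i|^2h_i^\vee$ for $i>0$; here $h^\vee,h_i^\vee$ are the dual Coxeter numbers and $\psi,\psi_i$ the highest roots of $\mathcal{G}$ and $\mathcal{G}_0^i$, with lengths measured by $\langle\ ,\ \rangle$ and its restriction. The fields $\jmath_k(z)$ are defined by $\sum_i\jmath^i_\mu(z)D^{i,\mu}=\jmath_k(z)D^k$. For a polynomial $P(q)$, $P(z)$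 is the field obtained by replacing $q^\alpha$ by $q^\alpha(z)$. Normal ordering: $:\phi(z)\psi(z):=\phi_+(z)\psi(z)+\psi(z)\phi_-(z)$ with $\phi_-(z)=\sum_{n\ge0}\phi[n]z^{-n-1}$, $\phi_+=\phi-\phi_-$. Wakimoto homomorphism. In $W(\mathcal{G},K,H)$ set $$\mathcal{J}_a(z)=-:p_\beta(z)\big(\Psi^\beta_\alpha(z)\mathcal{U}^\alpha_{\ a}(z)\big):+\sum_i\jmath^i_\mu(z)\mathcal{D}^{i,\mu}_a(z)+\big(K\Phi_\alpha^\beta(z)\mathcal{L}_{\beta,a}(z)+\Lambda_{\alpha,a}(z)\big)\partial_zq^\alpha(z).$$ It is known that $J_a(z)\mapsto\mathcal{J}_a(z)$ extends uniquely to a vertex algebra homomorphism $\mathcal{W}_H:A(\mathcal{G},K)\to W(\mathcal{G},K,H)$. Automorphisms. $\tau_A$ is the unique automorphism of the vertex algebra $A(\mathcal{G},K)$ extending $J_a(z)\mapsto\omega_aJ_a(z)$; $\tau_W$ is the unique automorphism of the vertex algebra $W(\mathcal{G},K,H)$ extending $(p_\alpha(z),q^\alpha(z),\jmath_k(z))\mapsto(\omega_\alpha p_\alpha(z),\omega^\alpha q^\alpha(z),\omega_{0,k}\jmath_k(z))$. *)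

theory Defs
  imports "HOL-Analysis.Analysis" "HOL-Library.Poly_Mapping"
begin

section \<open>Complex vector spaces and Lie algebras\<close>

class complex_vector_space = ab_group_add +
  fixes cscale :: "complex \<Rightarrow> 'a \<Rightarrow> 'a" (infixr "*\<^sub>C" 75)
  assumes cscale_add_right: "a *\<^sub>C (x + y) = a *\<^sub>C x + a *\<^sub>C y"
    and cscale_add_left: "(a + b) *\<^sub>C x = a *\<^sub>C x + b *\<^sub>C x"
    and cscale_cscale: "a *\<^sub>C b *\<^sub>C x = (a * b) *\<^sub>C x"
    and cscale_one: "1 *\<^sub>C x = x"

global_interpretation complex_vs: vector_space "cscale :: complex \<Rightarrow> 'a \<Rightarrow> 'a::complex_vector_space"
  defines csubspace = complex_vs.subspace
    and cspan = complex_vs.span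
  by unfold_locales (rule cscale_add_right cscale_add_left cscale_cscale cscale_one)+

abbreviation clinear :: "('a::complex_vector_space \<Rightarrow> 'b::complex_vector_space) \<Rightarrow> bool" where
  "clinear \<equiv> Vector_Spaces.linear cscale cscale"

class complex_lie_algebra = complex_vector_space +
  fixes lie :: "'a \<Rightarrow> 'a \<Rightarrow> 'a"
  assumes lie_add_left: "lie (x + y) z = lie x z + lie y z"
    and lie_add_right: "lie x (y + z) = lie x y + lie x z"
    and lie_scale_left: "lie (c *\<^sub>C x) y = c *\<^sub>C lie x y"
    and lie_scale_right: "lie x (c *\<^sub>C y) = c *\<^sub>C lie x y"
    and lie_self: "lie x x = 0"
    and jacobi: "lie x (lie y z) + lie y (lie z x) + lie z (lie x y) = 0"

definition lie_ideal :: "'g::complex_lie_algebra set \<Rightarrow> 'g set \<Rightarrow> bool" where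
  "lie_ideal S I \<longleftrightarrow> csubspace I \<and> I \<subseteq> S \<and> (\<forall>x\<in>S. \<forall>y\<in>I. lie x y \<in> I)"

definition lie_simple :: "'g::complex_lie_algebra set \<Rightarrow> bool" where
  "lie_simple S \<longleftrightarrow> csubspace S \<and> (\<forall>x\<in>S. \<forall>y\<in>S. lie x y \<in> S) \<and>
     (\<exists>x\<in>S. \<exists>y\<in>S. lie x y \<noteq> 0) \<and> (\<forall>I. lie_ideal S I \<longrightarrow> I = {0} \<or> I = S)"

definition finite_dimensional :: "'g::complex_vector_space set \<Rightarrow> bool" where
  "finite_dimensional S \<longleftrightarrow> (\<exists>E. finite E \<and> cspan E = S)"

definition invariant_form :: "('g::complex_lie_algebra \<Rightarrow> 'g \<Rightarrow> complex) \<Rightarrow> bool" where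
  "invariant_form B \<longleftrightarrow>
     (\<forall>x y z. B (x + y) z = B x z + B y z) \<and> (\<forall>c x y. B (c *\<^sub>C x) y = c * B x y) \<and>
     (\<forall>x y. B x y = B y x) \<and>
     (\<forall>x y z. B (lie x y) z = B x (lie y z)) \<and>
     (\<forall>x. (\<forall>y. B x y = 0) \<longrightarrow> x = 0)"

definition lie_automorphism :: "('g::complex_lie_algebra \<Rightarrow> 'g) \<Rightarrow> bool" where
  "lie_automorphism f \<longleftrightarrow> clinear f \<and> bij f \<and> (\<forall>x y. f (lie x y) = lie (f x) (f y))"

definition has_order :: "('g \<Rightarrow> 'g) \<Rightarrow> nat \<Rightarrow> bool" where
  "has_order f N \<longleftrightarrow> N > 0 \<and> f ^^ N = id \<and> (\<forall>k. 0 < k \<and> k < N \<longrightarrow> f ^^ k \<noteq> id)"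

definition grade :: "'g::complex_lie_algebra \<Rightarrow> int \<Rightarrow> 'g set" where
  "grade H m = {x. lie H x = of_int m *\<^sub>C x}"

definition integer_gradation :: "'g::complex_lie_algebra \<Rightarrow> bool" where
  "integer_gradation H \<longleftrightarrow> cspan (\<Union>m. grade H m) = UNIV"

definition neg_part :: "'g::complex_lie_algebra \<Rightarrow> 'g set" where
  "neg_part H = cspan (\<Union>m\<in>{..<0}. grade H m)"

definition pos_part :: "'g::complex_lie_algebra \<Rightarrow> 'g set" where
  "pos_part H = cspan (\<Union>m\<in>{0<..}. grade H m)"

definition joint_eigenvector ::
    "'g::complex_lie_algebra \<Rightarrow> ('g \<Rightarrow> 'g) \<Rightarrow> 'g \<Rightarrow> complex \<Rightarrow> bool" where
  "joint_eigenvector H \<tau> x c \<longleftrightarrow> (\<exists>m. x \<in> grade H m) \<and> \<tau> x = c *\<^sub>C x"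

text \<open>Linear independence of the two families follows from the duality relation.\<close>

definition dual_bases ::
    "('g::complex_lie_algebra \<Rightarrow> 'g \<Rightarrow> complex) \<Rightarrow> 'i set \<Rightarrow> ('i \<Rightarrow> 'g) \<Rightarrow> ('i \<Rightarrow> 'g) \<Rightarrow> 'g set \<Rightarrow> 'g set \<Rightarrow> bool"
  where
  "dual_bases B I e f V W \<longleftrightarrow> finite I \<and> cspan (e ` I) = V \<and> cspan (f ` I) = W \<and>
     (\<forall>i\<in>I. \<forall>j\<in>I. B (e i) (f j) = (if i = j then 1 else 0))"

text \<open>\<open>F 0\<close> is the Abelian factor of the grade-zero subalgebra, \<open>F 1, \<dots>, F r\<close> are its simple factors.\<close>

definition grade0_factors :: "'g::complex_lie_algebra \<Rightarrow> nat \<Rightarrow> (nat \<Rightarrow> 'g set) \<Rightarrow> bool" where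
  "grade0_factors H r F \<longleftrightarrow>
     (\<forall>i\<le>r. csubspace (F i) \<and> F i \<subseteq> grade H 0) \<and>
     (\<forall>x\<in>grade H 0. \<exists>!y. (\<forall>i\<le>r. y i \<in> F i) \<and> (\<forall>i>r. y i = 0) \<and> x = (\<Sum>i\<le>r. y i)) \<and>
     (\<forall>i\<le>r. \<forall>j\<le>r. i \<noteq> j \<longrightarrow> (\<forall>x\<in>F i. \<forall>y\<in>F j. lie x y = 0)) \<and>
     (\<forall>x\<in>F 0. \<forall>y\<in>F 0. lie x y = 0) \<and>
     (\<forall>i. 1 \<le> i \<and> i \<le> r \<longrightarrow> lie_simple (F i))"

lemma compatible_iff:
  fixes H :: "'g::complex_lie_algebra"
  assumes simple: "lie_simple (UNIV :: 'g set)" and grad: "integer_gradation H"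
    and aut: "lie_automorphism \<tau>"
  shows "\<tau> H = H \<longleftrightarrow> (\<forall>m. \<tau> ` grade H m = grade H m)"
proof
  have lin: "\<And>c x. \<tau> (c *\<^sub>C x) = c *\<^sub>C \<tau> x" and br: "\<And>x y. \<tau> (lie x y) = lie (\<tau> x) (\<tau> y)"
    and bij: "bij \<tau>"
    using aut unfolding lie_automorphism_def
    by (auto simp: Vector_Spaces.linear_iff)
  {
    assume fixH: "\<tau> H = H"
    have mem: "\<tau> x \<in> grade H m \<longleftrightarrow> x \<in> grade H m" for x m
    proof -
      have "lie H (\<tau> x) = of_int m *\<^sub>C \<tau> x \<longleftrightarrow> \<tau> (lie H x) = \<tau> (of_int m *\<^sub>C x)"
        by (simp add: lin br fixH)
      also have "\<dots> \<longleftrightarrow> lie H x = of_int m *\<^sub>C x"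
        using bij by (simp add: bij_def inj_eq)
      finally show ?thesis by (simp add: grade_def)
    qed
    show "\<forall>m. \<tau> ` grade H m = grade H m"
    proof (intro allI equalityI subsetI)
      fix m y assume "y \<in> grade H m"
      moreover obtain x where "y = \<tau> x" using bij by (metis bij_pointE)
      ultimately show "y \<in> \<tau> ` grade H m" using mem by auto
    qed (use mem in auto)
  }
  {
    assume inv: "\<forall>m. \<tau> ` grade H m = grade H m"
    define z where "z = \<tau> H - H"
    have lie_diff: "lie (a - b) x = lie a x - lie b x" for a b x :: 'g
      by (metis add_diff_cancel diff_add_cancel lie_add_left)
    have "(\<Union>m. grade H m) \<subseteq> {x. lie z x = 0}"
    proof
      fix x assume "x \<in> (\<Union>m. grade H m)"
      then obtain m where x: "x \<in> grade H m" by auto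
      then obtain y where y: "y \<in> grade H m" "x = \<tau> y" using inv by blast
      have "lie (\<tau> H) x = \<tau> (lie H y)" using y by (simp add: br)
      also have "\<dots> = lie H x" using x y by (simp add: grade_def lin)
      finally show "x \<in> {x. lie z x = 0}" by (simp add: z_def lie_diff)
    qed
    have zero_l: "lie 0 x = 0" and zero_r: "lie x 0 = 0" for x :: 'g
      using lie_add_left[of 0 0 x] lie_add_right[of x 0 0] by simp_all
    have "csubspace {x. lie z x = 0}"
      by (auto simp: complex_vs.subspace_def lie_add_right lie_scale_right zero_r)
    then have "cspan (\<Union>m. grade H m) \<subseteq> {x. lie z x = 0}"
      using \<open>(\<Union>m. grade H m) \<subseteq> _\<close> by (rule complex_vs.span_minimal[rotated])
    then have z: "lie z x = 0" for x using grad by (auto simp: integer_gradation_def)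
    define C where "C = {c. \<forall>x. lie c x = (0::'g)}"
    have anti: "lie x y = 0" if "lie y x = 0" for x y :: 'g
    proof -
      have "lie x y = lie (x + y) (x + y)"
        using that by (simp only: lie_add_left lie_add_right lie_self[of x] lie_self[of y]) simp
      then show ?thesis by (simp add: lie_self)
    qed
    have "lie_ideal UNIV C"
      by (auto simp: lie_ideal_def C_def complex_vs.subspace_def lie_add_left lie_scale_left zero_l anti)
    then have "C = {0} \<or> C = UNIV" using simple by (auto simp: lie_simple_def)
    moreover have "C \<noteq> UNIV" using simple by (auto simp: lie_simple_def C_def)
    ultimately have "z = 0" using z by (auto simp: C_def)
    then show "\<tau> H = H" by (simp add: z_def)
  }
qed

section \<open>Highest roots and dual Coxeter numbers\<close>

definition ad_semisimple :: "'g::complex_lie_algebra set \<Rightarrow> 'g \<Rightarrow> bool" where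
  "ad_semisimple S h \<longleftrightarrow> S \<subseteq> cspan {x\<in>S. \<exists>c. lie h x = c *\<^sub>C x}"

definition toral_subalgebra :: "'g::complex_lie_algebra set \<Rightarrow> 'g set \<Rightarrow> bool" where
  "toral_subalgebra S C \<longleftrightarrow> csubspace C \<and> C \<subseteq> S \<and> (\<forall>x\<in>C. \<forall>y\<in>C. lie x y \<in> C) \<and>
     (\<forall>h\<in>C. ad_semisimple S h)"

definition cartan_subalgebra :: "'g::complex_lie_algebra set \<Rightarrow> 'g set \<Rightarrow> bool" where
  "cartan_subalgebra S C \<longleftrightarrow> toral_subalgebra S C \<and>
     (\<forall>C'. toral_subalgebra S C' \<and> C \<subseteq> C' \<longrightarrow> C' = C)"

text \<open>A root, i.e. a linear form on the Cartan subalgebra \<open>C\<close>, is represented by the element of \<open>C\<close>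
  dual to it with respect to the invariant form; lengths of roots are then given by the form itself.\<close>

definition roots ::
    "('g::complex_lie_algebra \<Rightarrow> 'g \<Rightarrow> complex) \<Rightarrow> 'g set \<Rightarrow> 'g set \<Rightarrow> 'g set" where
  "roots B S C = {t\<in>C. t \<noteq> 0 \<and> (\<exists>x\<in>S. x \<noteq> 0 \<and> (\<forall>h\<in>C. lie h x = B t h *\<^sub>C x))}"

definition positive_roots :: "'g::ab_group_add set \<Rightarrow> 'g set \<Rightarrow> bool" where
  "positive_roots R P \<longleftrightarrow> P \<subseteq> R \<and> (\<forall>t\<in>R. (t \<in> P) \<noteq> (- t \<in> P)) \<and>
     (\<forall>s\<in>P. \<forall>t\<in>P. s + t \<in> R \<longrightarrow> s + t \<in> P)"

definition highest_root :: "'g::ab_group_add set \<Rightarrow> 'g set \<Rightarrow> 'g \<Rightarrow> bool" where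
  "highest_root R P \<psi> \<longleftrightarrow> \<psi> \<in> P \<and> (\<forall>t\<in>P. \<psi> + t \<notin> R)"

text \<open>\<open>1 + (\<rho>, \<psi>\<^sup>\<or>)\<close>, with \<open>\<rho>\<close> half the sum of the positive roots and \<open>\<psi>\<^sup>\<or> = 2 \<psi> / |\<psi>|\<^sup>2\<close>.\<close>

definition dual_coxeter :: "('g \<Rightarrow> 'g \<Rightarrow> complex) \<Rightarrow> 'g set \<Rightarrow> 'g \<Rightarrow> complex" where
  "dual_coxeter B P \<psi> = 1 + (\<Sum>t\<in>P. B t \<psi>) / B \<psi> \<psi>"

definition highest_root_and_dual_coxeter ::
    "('g::complex_lie_algebra \<Rightarrow> 'g \<Rightarrow> complex) \<Rightarrow> 'g set \<Rightarrow> 'g \<Rightarrow> complex \<Rightarrow> bool" where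
  "highest_root_and_dual_coxeter B S \<psi> h \<longleftrightarrow>
     (\<exists>C P. cartan_subalgebra S C \<and> positive_roots (roots B S C) P \<and>
        highest_root (roots B S C) P \<psi> \<and> h = dual_coxeter B P \<psi>)"

section \<open>Polynomials in the coordinates of the negative part\<close>

type_synonym mpoly = "(nat \<Rightarrow>\<^sub>0 nat) \<Rightarrow>\<^sub>0 complex"

definition mpoly_in :: "nat \<Rightarrow> mpoly \<Rightarrow> bool" where
  "mpoly_in m P \<longleftrightarrow> (\<forall>e\<in>Poly_Mapping.keys P. Poly_Mapping.keys e \<subseteq> {..<m})"

definition eval :: "mpoly \<Rightarrow> (nat \<Rightarrow> complex) \<Rightarrow> complex" where
  "eval P x = (\<Sum>e\<in>Poly_Mapping.keys P.
     Poly_Mapping.lookup P e * (\<Prod>\<alpha>\<in>Poly_Mapping.keys e. x \<alpha> ^ Poly_Mapping.lookup e \<alpha>))"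

definition partial_derivative :: "nat \<Rightarrow> ((nat \<Rightarrow> complex) \<Rightarrow> complex) \<Rightarrow> (nat \<Rightarrow> complex) \<Rightarrow> complex" where
  "partial_derivative \<alpha> f x = deriv (\<lambda>t. f (x(\<alpha> := t))) (x \<alpha>)"

definition neg_element :: "nat \<Rightarrow> (nat \<Rightarrow> 'g::complex_lie_algebra) \<Rightarrow> (nat \<Rightarrow> complex) \<Rightarrow> 'g" where
  "neg_element m L x = (\<Sum>\<alpha><m. x \<alpha> *\<^sub>C L \<alpha>)"

text \<open>The exponential of \<open>ad q\<close> applied to \<open>X\<close>; it is used for ad-nilpotent \<open>q\<close> only, where
  the series is finite.\<close>

definition exp_ad :: "'g::complex_lie_algebra \<Rightarrow> 'g \<Rightarrow> 'g" where
  "exp_ad q X = Sum_any (\<lambda>k. (1 / fact k) *\<^sub>C (lie q ^^ k) X)"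

section \<open>Fields and vertex algebras\<close>

text \<open>A field \<open>\<phi>(z) = \<Sum>n. \<phi>[n] z^(-n-1)\<close> is given by its modes \<open>n \<mapsto> \<phi>[n]\<close>.\<close>

type_synonym 'v fld = "int \<Rightarrow> 'v \<Rightarrow> 'v"

definition fld_one :: "'v::complex_vector_space fld" where
  "fld_one n v = (if n = -1 then v else 0)"

text \<open>The product \<open>\<phi>(z) \<psi>(z)\<close> at one point. It is applied only to pairs for which, on each vector,
  only finitely many terms of the sum are nonzero: commuting fields, and the two halves of a normally
  ordered product.\<close>

definition fld_mult :: "'v::complex_vector_space fld \<Rightarrow> 'v fld \<Rightarrow> 'v fld" where
  "fld_mult \<phi> \<psi> n v = Sum_any (\<lambda>k. \<phi> k (\<psi> (n - k - 1) v))"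

definition fld_minus :: "'v::complex_vector_space fld \<Rightarrow> 'v fld" where
  "fld_minus \<phi> n v = (if n \<ge> 0 then \<phi> n v else 0)"

definition fld_plus :: "'v::complex_vector_space fld \<Rightarrow> 'v fld" where
  "fld_plus \<phi> n v = \<phi> n v - fld_minus \<phi> n v"

definition normal_ordered :: "'v::complex_vector_space fld \<Rightarrow> 'v fld \<Rightarrow> 'v fld" where
  "normal_ordered \<phi> \<psi> n v = fld_mult (fld_plus \<phi>) \<psi> n v + fld_mult \<psi> (fld_minus \<phi>) n v"

definition fld_deriv :: "'v::complex_vector_space fld \<Rightarrow> 'v fld" where
  "fld_deriv \<phi> n v = (- of_int n) *\<^sub>C \<phi> (n - 1) v"

definition monomial_field :: "(nat \<Rightarrow> 'v::complex_vector_space fld) \<Rightarrow> (nat \<Rightarrow>\<^sub>0 nat) \<Rightarrow> 'v fld" where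
  "monomial_field q e = foldr fld_mult
     (concat (map (\<lambda>\<alpha>. replicate (Poly_Mapping.lookup e \<alpha>) (q \<alpha>))
       (sorted_list_of_set (Poly_Mapping.keys e)))) fld_one"

definition poly_field :: "(nat \<Rightarrow> 'v::complex_vector_space fld) \<Rightarrow> mpoly \<Rightarrow> 'v fld" where
  "poly_field q P n v =
     (\<Sum>e\<in>Poly_Mapping.keys P. Poly_Mapping.lookup P e *\<^sub>C monomial_field q e n v)"

record 'v vertex_algebra =
  vacuum :: 'v
  translation :: "'v \<Rightarrow> 'v"
  mode :: "'v \<Rightarrow> 'v fld"

text \<open>The last condition is locality, \<open>(z - w)^N [Y(a,z), Y(b,w)] = 0\<close>, written in modes.\<close>

definition is_vertex_algebra :: "'v::complex_vector_space vertex_algebra \<Rightarrow> bool" where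
  "is_vertex_algebra V \<longleftrightarrow>
     clinear (translation V) \<and>
     (\<forall>a n. clinear (mode V a n)) \<and> (\<forall>b n. clinear (\<lambda>a. mode V a n b)) \<and>
     (\<forall>a b. \<exists>N. \<forall>n\<ge>N. mode V a n b = 0) \<and>
     mode V (vacuum V) = fld_one \<and>
     (\<forall>a. mode V a (-1) (vacuum V) = a \<and> (\<forall>n\<ge>0. mode V a n (vacuum V) = 0)) \<and>
     translation V (vacuum V) = 0 \<and>
     (\<forall>a n b. translation V (mode V a n b) - mode V a n (translation V b) = fld_deriv (mode V a) n b) \<and>
     (\<forall>a b. \<exists>N::nat. \<forall>m n c. (\<Sum>j\<le>N. ((-1) ^ j * of_nat (N choose j)) *\<^sub>C
        (mode V a (m + int N - int j) (mode V b (n + int j) c)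
         - mode V b (n + int j) (mode V a (m + int N - int j) c))) = 0)"

definition va_hom ::
    "'v::complex_vector_space vertex_algebra \<Rightarrow> 'w::complex_vector_space vertex_algebra \<Rightarrow> ('v \<Rightarrow> 'w) \<Rightarrow> bool"
  where
  "va_hom V W f \<longleftrightarrow> clinear f \<and> f (vacuum V) = vacuum W \<and>
     (\<forall>a n b. f (mode V a n b) = mode W (f a) n (f b))"

definition va_automorphism :: "'v::complex_vector_space vertex_algebra \<Rightarrow> ('v \<Rightarrow> 'v) \<Rightarrow> bool" where
  "va_automorphism V f \<longleftrightarrow> va_hom V V f \<and> bij f"

section \<open>Vacuum modules given by generators and commutators\<close>

text \<open>Elements of the free associative algebra on symbols \<open>(s, n)\<close>, which stand for the modes
  \<open>\<phi>\<^sub>s[n]\<close>, are finite linear combinations of words.\<close>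

type_synonym 's free_algebra = "('s \<times> int) list \<Rightarrow>\<^sub>0 complex"

definition words :: "'s set \<Rightarrow> ('s \<times> int) list set" where
  "words S = {u. fst ` set u \<subseteq> S}"

definition act :: "('s \<Rightarrow> 'v::complex_vector_space fld) \<Rightarrow> 's free_algebra \<Rightarrow> 'v \<Rightarrow> 'v" where
  "act \<phi> f v = (\<Sum>u\<in>Poly_Mapping.keys f. Poly_Mapping.lookup f u *\<^sub>C foldr (\<lambda>(s, n). \<phi> s n) u v)"

definition surround :: "('s \<times> int) list \<Rightarrow> 's free_algebra \<Rightarrow> ('s \<times> int) list \<Rightarrow> complex \<Rightarrow> 's free_algebra"
  where
  "surround u f v c = (\<Sum>w\<in>Poly_Mapping.keys f. Poly_Mapping.single (u @ w @ v) (c * Poly_Mapping.lookup f w))"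

text \<open>The left ideal generated by the nonnegative modes and by the two-sided ideal of the commutation
  relations \<open>[\<phi>\<^sub>s[m], \<phi>\<^sub>t[n]] = br (s, m) (t, n)\<close>.\<close>

inductive vacuum_relation ::
    "'s set \<Rightarrow> ('s \<times> int \<Rightarrow> 's \<times> int \<Rightarrow> 's free_algebra) \<Rightarrow> 's free_algebra \<Rightarrow> bool"
  for S br where
  zero: "vacuum_relation S br 0"
| add: "vacuum_relation S br f \<Longrightarrow> vacuum_relation S br g \<Longrightarrow> vacuum_relation S br (f + g)"
| commutator: "u \<in> words S \<Longrightarrow> v \<in> words S \<Longrightarrow> fst x \<in> S \<Longrightarrow> fst y \<in> S \<Longrightarrow>
    vacuum_relation S br
      (surround u (Poly_Mapping.single [x, y] 1 - Poly_Mapping.single [y, x] 1 - br x y) v c)"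
| annihilation: "u \<in> words S \<Longrightarrow> s \<in> S \<Longrightarrow> n \<ge> 0 \<Longrightarrow>
    vacuum_relation S br (Poly_Mapping.single (u @ [(s, n)]) c)"

text \<open>The fields \<open>\<phi> s\<close>, \<open>s \<in> S\<close>, have the commutators \<open>br\<close> and kill the vacuum with their nonnegative
  modes; their modes generate the whole space from the vacuum; and the space is the universal such
  module (for an affine Lie algebra: the vacuum Verma module), i.e. a combination of words kills the
  vacuum only if this follows from the relations.\<close>

definition vacuum_module ::
    "'s set \<Rightarrow> ('s \<times> int \<Rightarrow> 's \<times> int \<Rightarrow> 's free_algebra) \<Rightarrow>
      ('s \<Rightarrow> 'v::complex_vector_space fld) \<Rightarrow> 'v \<Rightarrow> bool" where
  "vacuum_module S br \<phi> vac \<longleftrightarrow>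
     (\<forall>s\<in>S. \<forall>t\<in>S. \<forall>m n v. \<phi> s m (\<phi> t n v) - \<phi> t n (\<phi> s m v) = act \<phi> (br (s, m) (t, n)) v) \<and>
     (\<forall>s\<in>S. \<forall>n\<ge>0. \<phi> s n vac = 0) \<and>
     (\<forall>v. \<exists>f. Poly_Mapping.keys f \<subseteq> words S \<and> v = act \<phi> f vac) \<and>
     (\<forall>f. Poly_Mapping.keys f \<subseteq> words S \<and> act \<phi> f vac = 0 \<longrightarrow> vacuum_relation S br f)"

definition va_generated ::
    "'v::complex_vector_space vertex_algebra \<Rightarrow> 's set \<Rightarrow> ('s \<times> int \<Rightarrow> 's \<times> int \<Rightarrow> 's free_algebra) \<Rightarrow>
      ('s \<Rightarrow> 'v) \<Rightarrow> bool" where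
  "va_generated V S br g \<longleftrightarrow> is_vertex_algebra V \<and> vacuum_module S br (\<lambda>s. mode V (g s)) (vacuum V)"

text \<open>In modes, \<open>\<phi>(w) \<delta>(z,w)\<close>, \<open>\<delta>(z,w)\<close> and \<open>\<partial>\<^sub>w \<delta>(z,w)\<close> contribute \<open>\<phi>[m+n]\<close>, \<open>\<delta>\<^bsub>m+n,-1\<^esub>\<close> and
  \<open>m \<delta>\<^bsub>m+n,0\<^esub>\<close> to the commutator of the modes \<open>m\<close> and \<open>n\<close>.\<close>

definition delta_term :: "int \<Rightarrow> int \<Rightarrow> complex \<Rightarrow> 's free_algebra" where
  "delta_term m n c = Poly_Mapping.single [] (if m + n = -1 then c else 0)"

definition delta_deriv_term :: "int \<Rightarrow> int \<Rightarrow> complex \<Rightarrow> 's free_algebra" where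
  "delta_deriv_term m n c = Poly_Mapping.single [] (if m + n = 0 then of_int m * c else 0)"

fun affine_commutator ::
    "('g::complex_lie_algebra \<Rightarrow> 'g \<Rightarrow> complex) \<Rightarrow> complex \<Rightarrow> nat \<Rightarrow> (nat \<Rightarrow> 'g) \<Rightarrow> (nat \<Rightarrow> 'g) \<Rightarrow>
      nat \<times> int \<Rightarrow> nat \<times> int \<Rightarrow> nat free_algebra" where
  "affine_commutator B K d Tlo Tup (a, m) (b, n) =
     (\<Sum>c<d. Poly_Mapping.single [(c, m + n)] (B (lie (Tlo a) (Tlo b)) (Tup c)))
     + delta_deriv_term m n (K * B (Tlo a) (Tlo b))"

datatype wgen = Pgen nat | Qgen nat | Jgen nat nat

definition wgens :: "nat \<Rightarrow> nat \<Rightarrow> (nat \<Rightarrow> nat) \<Rightarrow> wgen set" where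
  "wgens m r dim0 = Pgen ` {..<m} \<union> Qgen ` {..<m} \<union> (\<Union>i\<le>r. Jgen i ` {..<dim0 i})"

fun w_commutator ::
    "('g::complex_lie_algebra \<Rightarrow> 'g \<Rightarrow> complex) \<Rightarrow> (nat \<Rightarrow> complex) \<Rightarrow> (nat \<Rightarrow> nat) \<Rightarrow>
      (nat \<Rightarrow> nat \<Rightarrow> 'g) \<Rightarrow> (nat \<Rightarrow> nat \<Rightarrow> 'g) \<Rightarrow> wgen \<times> int \<Rightarrow> wgen \<times> int \<Rightarrow> wgen free_algebra" where
  "w_commutator B K0 dim0 Dlo Dup (Qgen \<alpha>, m) (Pgen \<beta>, n) = delta_term m n (if \<alpha> = \<beta> then 1 else 0)"
| "w_commutator B K0 dim0 Dlo Dup (Pgen \<beta>, m) (Qgen \<alpha>, n) = - delta_term m n (if \<alpha> = \<beta> then 1 else 0)"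
| "w_commutator B K0 dim0 Dlo Dup (Jgen i \<mu>, m) (Jgen j \<nu>, n) =
     (if i = j then
        (\<Sum>\<theta><dim0 i. Poly_Mapping.single [(Jgen i \<theta>, m + n)] (B (lie (Dlo i \<mu>) (Dlo i \<nu>)) (Dup i \<theta>)))
        + delta_deriv_term m n (K0 i * B (Dlo i \<mu>) (Dlo i \<nu>))
      else 0)"
| "w_commutator B K0 dim0 Dlo Dup _ _ = 0"

text \<open>The free-field current with index \<open>a\<close>; \<open>p\<close>, \<open>q\<close>, \<open>j\<close> are the free fields, and
  \<open>\<Phi> \<alpha> \<beta>\<close>, \<open>\<Psi> \<alpha> \<beta>\<close> have lower index \<open>\<alpha>\<close> and upper index \<open>\<beta>\<close>.\<close>

definition wakimoto_current ::
    "nat \<Rightarrow> nat \<Rightarrow> (nat \<Rightarrow> nat) \<Rightarrow> complex \<Rightarrow> (nat \<Rightarrow> nat \<Rightarrow> mpoly) \<Rightarrow> (nat \<Rightarrow> nat \<Rightarrow> mpoly) \<Rightarrow>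
      (nat \<Rightarrow> nat \<Rightarrow> mpoly) \<Rightarrow> (nat \<Rightarrow> nat \<Rightarrow> mpoly) \<Rightarrow> (nat \<Rightarrow> nat \<Rightarrow> nat \<Rightarrow> mpoly) \<Rightarrow> (nat \<Rightarrow> nat \<Rightarrow> mpoly) \<Rightarrow>
      (nat \<Rightarrow> 'v::complex_vector_space fld) \<Rightarrow> (nat \<Rightarrow> 'v fld) \<Rightarrow> (nat \<Rightarrow> nat \<Rightarrow> 'v fld) \<Rightarrow> nat \<Rightarrow> 'v fld" where
  "wakimoto_current m r dim0 K \<Phi> \<Psi> \<U> \<L> \<D> \<Lambda> p q j a n v =
     - (\<Sum>\<beta><m. normal_ordered (p \<beta>)
          (\<lambda>n v. \<Sum>\<alpha><m. fld_mult (poly_field q (\<Psi> \<alpha> \<beta>)) (poly_field q (\<U> \<alpha> a)) n v) n v)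
     + (\<Sum>i\<le>r. \<Sum>\<mu><dim0 i. fld_mult (j i \<mu>) (poly_field q (\<D> i \<mu> a)) n v)
     + (\<Sum>\<alpha><m. fld_mult
          (\<lambda>n v. K *\<^sub>C (\<Sum>\<beta><m. fld_mult (poly_field q (\<Phi> \<alpha> \<beta>)) (poly_field q (\<L> \<beta> a)) n v)
                 + poly_field q (\<Lambda> \<alpha> a) n v)
          (fld_deriv (q \<alpha>)) n v)"

end

(* The weights of the generators are forced by the pairings: the levels K <T_a, T_b> occur in
   J_a[1] J_b[-1] |0>, so the existence of the automorphism of A(G, K) makes tau an isometry of the form,
   and dual basis vectors have inverse eigenvalues. Since tau commutes with exp ad, replacing q by tau q
   multiplies each of the polynomials U, L, Phi, Psi, Lambda by a constant; as distinct monomials are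
   linearly independent characters, every monomial that occurs in such a polynomial has the same weight,
   and the corresponding field in the q^alpha(z) is multiplied by the inverse constant under tau_W. The
   weights in each term of the current add up to that of T_a. In the remaining term, the sum over the j^i_mu,
   the basis is first changed to one of tau-eigenvectors, with the current evaluated only in its mode -1 on
   the vacuum, which determines it. Both compositions are homomorphisms, so agreement on the generating
   currents is enough. *)
theory Submission
  imports Defs "Jordan_Normal_Form.Determinant"
begin

section \<open>Linear algebra and polynomials\<close>

text \<open>Products of fields are sums \<open>Sum_any\<close>, which is 0 on families of infinite
  support. Scalars and injective linear maps pass through such a sum, but additivity is available
  only where finiteness is known. Hence weights are propagated through products by homogeneity of
  the fields alone, and the terms of the current with p and with the derivative of q are handled as
  whole fields. The grade-zero term resists this: the basis \<open>Dup i \<mu>\<close> is adapted to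
  the factors of the grade-zero subalgebra, which \<tau> may permute, so a single summand has no
  weight in general, and regrouping the sum uses additivity of the product in both factors. In mode
  -1 on the vacuum each of these products consists of one summand, where additivity is
  clear.\<close>

global_interpretation complex_vs_pair: vector_space_pair
  "cscale :: complex \<Rightarrow> 'a \<Rightarrow> 'a::complex_vector_space"
  "cscale :: complex \<Rightarrow> 'b \<Rightarrow> 'b::complex_vector_space"
  by unfold_locales

lemma clinear_inj_eq_0_iff: "clinear f \<Longrightarrow> inj f \<Longrightarrow> f x = 0 \<longleftrightarrow> x = 0"
  using complex_vs_pair.linear_0 by (metis injD)

text \<open>No summability is needed: an injective linear map preserves supports, and \<open>Sum_any\<close> is \<open>0\<close> for
  families of infinite support.\<close>

lemma clinear_Sum_any:
  assumes "clinear f" "inj f"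
  shows "f (Sum_any g) = Sum_any (\<lambda>k. f (g k))"
proof -
  have "f (Sum_any g) = (\<Sum>k | g k \<noteq> 0. f (g k))"
    by (simp add: Sum_any.expand_set complex_vs_pair.linear_sum[OF assms(1)])
  also have "{k. g k \<noteq> 0} = {k. f (g k) \<noteq> 0}"
    by (simp add: clinear_inj_eq_0_iff[OF assms])
  finally show ?thesis by (simp add: Sum_any.expand_set)
qed

lemma clinear_cscale: "clinear (\<lambda>x. c *\<^sub>C x)"
  by (simp add: Vector_Spaces.linear_iff complex_vs.scale_right_distrib mult.commute
      complex_vs.vector_space_axioms)

text \<open>For c \<noteq> 0 multiplication by c is injective; for c = 0 both sides are 0.\<close>

lemma cscale_Sum_any: "c *\<^sub>C Sum_any g = Sum_any (\<lambda>k. c *\<^sub>C g k)"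
proof (cases "c = 0")
  case False
  then show ?thesis
    by (intro clinear_Sum_any clinear_cscale) (auto intro: injI)
qed simp

section \<open>Coordinates with respect to dual bases\<close>

lemma dual_basis_coefficient:
  assumes form: "invariant_form B" and dual: "dual_bases B I e f V W" and "i \<in> I"
  shows "B (e i) (\<Sum>j\<in>I. c j *\<^sub>C f j) = c i"
proof -
  have add: "B x (y + z) = B x y + B x z" and scale: "B x (a *\<^sub>C y) = a * B x y" for x y z a
    using form unfolding invariant_form_def by metis+
  have zero: "B x 0 = 0" for x using scale[of x 0 0] by simp
  have sum: "B x (sum g S) = (\<Sum>j\<in>S. B x (g j))" for x g and S :: "'b set"
    by (induction S rule: infinite_finite_induct) (auto simp: add zero)
  have "B (e i) (\<Sum>j\<in>I. c j *\<^sub>C f j) = (\<Sum>j\<in>I. if i = j then c j else 0)"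
    unfolding sum scale using dual \<open>i \<in> I\<close>
    by (intro sum.cong) (auto simp: dual_bases_def)
  then show ?thesis using dual \<open>i \<in> I\<close> by (simp add: dual_bases_def)
qed

text \<open>The vectors that equal their own expansion form a subspace, and duality puts every
  \<open>f j\<close> into it.\<close>

lemma dual_basis_expansion:
  assumes form: "invariant_form B" and dual: "dual_bases B I e f V W" and "x \<in> W"
  shows "x = (\<Sum>i\<in>I. B (e i) x *\<^sub>C f i)"
proof -
  have fin: "finite I" using dual by (simp add: dual_bases_def)
  have add: "B x (y + z) = B x y + B x z" and scale: "B x (a *\<^sub>C y) = a * B x y" for x y z a
    using form unfolding invariant_form_def by metis+
  have zero: "B x 0 = 0" for x using scale[of x 0 0] by simp
  let ?S = "{x. x = (\<Sum>i\<in>I. B (e i) x *\<^sub>C f i)}"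
  have "csubspace ?S"
  proof (rule complex_vs.subspaceI)
    fix c x assume "x \<in> ?S"
    then have "c *\<^sub>C x = c *\<^sub>C (\<Sum>i\<in>I. B (e i) x *\<^sub>C f i)" by simp
    also have "\<dots> = (\<Sum>i\<in>I. B (e i) (c *\<^sub>C x) *\<^sub>C f i)"
      by (simp add: scale complex_vs.scale_sum_right)
    finally show "c *\<^sub>C x \<in> ?S" by simp
  qed (auto simp: add zero complex_vs.scale_left_distrib sum.distrib)
  moreover have "f ` I \<subseteq> ?S"
  proof safe
    fix j assume "j \<in> I"
    have "(\<Sum>i\<in>I. B (e i) (f j) *\<^sub>C f i) = (\<Sum>i\<in>I. if i = j then f i else 0)"
      using dual \<open>j \<in> I\<close> by (intro sum.cong) (auto simp: dual_bases_def)
    then show "f j = (\<Sum>i\<in>I. B (e i) (f j) *\<^sub>C f i)"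
      using fin \<open>j \<in> I\<close> by simp
  qed
  ultimately have "cspan (f ` I) \<subseteq> ?S" by (rule complex_vs.span_minimal[rotated])
  then show ?thesis using \<open>x \<in> W\<close> dual by (auto simp: dual_bases_def)
qed

lemma dual_bases_commute:
  assumes "invariant_form B" "dual_bases B I e f V W"
  shows "dual_bases B I f e W V"
proof -
  have "B (f i) (e j) = (if i = j then 1 else 0)" if "i \<in> I" "j \<in> I" for i j
  proof -
    have "B (f i) (e j) = B (e j) (f i)" using assms(1) unfolding invariant_form_def by blast
    also have "\<dots> = (if i = j then 1 else 0)" using assms(2) that by (auto simp: dual_bases_def)
    finally show ?thesis .
  qed
  then show ?thesis using assms(2) by (simp add: dual_bases_def)
qed

text \<open>A right inverse of a square matrix is also a left inverse, so G = G (F G') = (G F) G' =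
  G'. This transfers weights from \<Phi> to \<Psi>, which is given as a right inverse.\<close>

lemma right_inverse_unique_square:
  fixes F G G' :: "nat \<Rightarrow> nat \<Rightarrow> 'a::field"
  assumes G: "\<And>i k. i < m \<Longrightarrow> k < m \<Longrightarrow> (\<Sum>j<m. F i j * G j k) = (if i = k then 1 else 0)"
    and G': "\<And>i k. i < m \<Longrightarrow> k < m \<Longrightarrow> (\<Sum>j<m. F i j * G' j k) = (if i = k then 1 else 0)"
    and "i < m" "k < m"
  shows "G i k = G' i k"
proof -
  let ?M = "\<lambda>X. mat m m (\<lambda>(i, j). X i j)"
  have prod: "?M F * ?M X = 1\<^sub>m m"
    if "\<And>i k. i < m \<Longrightarrow> k < m \<Longrightarrow> (\<Sum>j<m. F i j * X j k) = (if i = k then 1 else 0)" for X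
  proof (rule eq_matI)
    fix i k assume ik: "i < dim_row (1\<^sub>m m :: 'a mat)" "k < dim_col (1\<^sub>m m :: 'a mat)"
    then have "(?M F * ?M X) $$ (i, k) = (\<Sum>j<m. F i j * X j k)"
      by (simp add: scalar_prod_def lessThan_atLeast0)
    also have "\<dots> = 1\<^sub>m m $$ (i, k)"
      using ik by (subst that) simp_all
    finally show "(?M F * ?M X) $$ (i, k) = 1\<^sub>m m $$ (i, k)" .
  qed simp_all
  have left: "?M G * ?M F = 1\<^sub>m m"
    by (rule mat_mult_left_right_inverse[OF _ _ prod[OF G]]) simp_all
  have "?M G = ?M G * (?M F * ?M G')" by (simp add: prod[OF G'])
  also have "\<dots> = (?M G * ?M F) * ?M G'" by (simp add: assoc_mult_mat[of _ m m _ m _ m])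
  also have "\<dots> = ?M G'" by (simp add: left)
  finally have "?M G $$ (i, k) = ?M G' $$ (i, k)" by simp
  then show ?thesis using \<open>i < m\<close> \<open>k < m\<close> by simp
qed

text \<open>Plays two roles: at a point of the negative part it is the value of the monomial, and at
  the vector of weights of the variables it is the weight of the monomial.\<close>

definition monom_value :: "(nat \<Rightarrow>\<^sub>0 nat) \<Rightarrow> (nat \<Rightarrow> complex) \<Rightarrow> complex" where
  "monom_value e x = (\<Prod>\<alpha>\<in>Poly_Mapping.keys e. x \<alpha> ^ Poly_Mapping.lookup e \<alpha>)"

lemma eval_monom_value:
  "eval P x = (\<Sum>e\<in>Poly_Mapping.keys P. Poly_Mapping.lookup P e * monom_value e x)"
  by (simp add: eval_def monom_value_def)

lemma monom_value_mult: "monom_value e (\<lambda>\<alpha>. x \<alpha> * y \<alpha>) = monom_value e x * monom_value e y"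
  by (simp add: monom_value_def power_mult_distrib prod.distrib)

lemma monom_value_one: "monom_value e (\<lambda>_. 1) = 1"
  by (simp add: monom_value_def)

lemma monom_value_inject:
  assumes "\<And>x. monom_value e x = monom_value e' x"
  shows "e = e'"
proof (rule poly_mapping_eqI)
  fix \<alpha>
  \<comment> \<open>The point with coordinate 2 at \<alpha> and 1 elsewhere isolates the exponent of
    \<alpha>, which the power of 2 determines.\<close>
  have "monom_value e ((\<lambda>_. 1)(\<alpha> := 2)) = 2 ^ Poly_Mapping.lookup e \<alpha>" for e
  proof -
    have "monom_value e ((\<lambda>_. 1)(\<alpha> := 2)) =
        (\<Prod>\<beta>\<in>Poly_Mapping.keys e. if \<beta> = \<alpha> then 2 ^ Poly_Mapping.lookup e \<beta> else 1)"
      unfolding monom_value_def by (intro prod.cong) auto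
    also have "\<dots> = (if \<alpha> \<in> Poly_Mapping.keys e then 2 ^ Poly_Mapping.lookup e \<alpha> else 1)"
      by (subst prod.delta) auto
    also have "\<dots> = 2 ^ Poly_Mapping.lookup e \<alpha>" by (auto simp: in_keys_iff)
    finally show ?thesis .
  qed
  then have "(2::complex) ^ Poly_Mapping.lookup e \<alpha> = 2 ^ Poly_Mapping.lookup e' \<alpha>"
    using assms by metis
  then have "(2::real) ^ Poly_Mapping.lookup e \<alpha> = 2 ^ Poly_Mapping.lookup e' \<alpha>"
    by (metis norm_numeral norm_power)
  then show "Poly_Mapping.lookup e \<alpha> = Poly_Mapping.lookup e' \<alpha>" by simp
qed

text \<open>Monomials are characters of the multiplicative monoid of points, so this is Dedekind's lemma on
  the independence of characters.\<close>

lemma monom_value_independent: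
  assumes "finite S" "\<And>x. (\<Sum>e\<in>S. c e * monom_value e x) = 0" "e \<in> S"
  shows "c e = 0"
  using assms
proof (induction S arbitrary: c e rule: finite_induct)
  case (insert e0 S)
  have S: "c e = 0" if "e \<in> S" for e
  proof -
    have "e \<noteq> e0" using that insert.hyps by auto
    then obtain y where y: "monom_value e y \<noteq> monom_value e0 y"
      using monom_value_inject by blast
    \<comment> \<open>The relation translated by y, minus \<open>monom_value e0 y\<close> times the
      relation itself: the term of \<open>e0\<close> cancels and the others keep a nonzero factor
      for a suitable y.\<close>
    have "(\<Sum>e\<in>S. (c e * (monom_value e y - monom_value e0 y)) * monom_value e x) = 0" for x
    proof -
      have "(\<Sum>e\<in>S. (c e * (monom_value e y - monom_value e0 y)) * monom_value e x) =
          (\<Sum>e\<in>insert e0 S. (c e * (monom_value e y - monom_value e0 y)) * monom_value e x)"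
        using insert.hyps by simp
      also have "\<dots> = (\<Sum>e\<in>insert e0 S. c e * monom_value e (\<lambda>\<alpha>. y \<alpha> * x \<alpha>))
          - monom_value e0 y * (\<Sum>e\<in>insert e0 S. c e * monom_value e x)"
        by (simp only: monom_value_mult sum_distrib_left flip: sum_subtractf)
          (simp add: algebra_simps)
      also have "\<dots> = 0" by (simp only: insert.prems) simp
      finally show ?thesis .
    qed
    from insert.IH[OF this that] y show ?thesis by simp
  qed
  have "c e0 * monom_value e0 (\<lambda>_. 1) = 0"
    using insert.prems(1)[of "\<lambda>_. 1"] insert.hyps S by simp
  then have "c e0 = 0" by (simp add: monom_value_one)
  then show ?case using S insert.prems(2) by auto
qed simp

text \<open>The difference of the two sides is a relation among monomials with coefficients
  \<open>c e * (monom_value e w - b)\<close>, so independence makes each of them vanish.\<close>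

lemma monom_value_weight:
  assumes "finite S"
    and weight: "\<And>x. (\<Sum>e\<in>S. c e * monom_value e (\<lambda>\<alpha>. w \<alpha> * x \<alpha>)) = b * (\<Sum>e\<in>S. c e * monom_value e x)"
    and "e \<in> S" "c e \<noteq> 0"
  shows "monom_value e w = b"
proof -
  have "(\<Sum>e\<in>S. (c e * (monom_value e w - b)) * monom_value e x) = 0" for x
    using weight[of x] unfolding monom_value_mult sum_distrib_left
    by (simp add: algebra_simps sum_subtractf)
  from monom_value_independent[OF assms(1) this assms(3)] assms(4) show ?thesis by simp
qed

lemma monom_value_inverse_weight:
  assumes "Poly_Mapping.keys e \<subseteq> {..<m}" "\<And>\<alpha>. \<alpha> < m \<Longrightarrow> w \<alpha> * w' \<alpha> = 1"
  shows "monom_value e w * monom_value e w' = 1"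
proof -
  have "monom_value e w * monom_value e w' =
      (\<Prod>\<alpha>\<in>Poly_Mapping.keys e. (w \<alpha> * w' \<alpha>) ^ Poly_Mapping.lookup e \<alpha>)"
    by (simp add: monom_value_def power_mult_distrib prod.distrib)
  also have "\<dots> = 1" using assms by (intro prod.neutral) auto
  finally show ?thesis .
qed

text \<open>\<open>partial_derivative\<close> is built on \<open>deriv\<close>, which is a true
  derivative only where one exists.\<close>

lemma eval_field_differentiable:
  "(\<lambda>t. eval P (x(\<alpha> := t))) field_differentiable at s"
proof -
  have pow: "(\<lambda>t. (x(\<alpha> := t)) \<beta> ^ k) field_differentiable at s" for \<beta> k
    by (cases "\<beta> = \<alpha>") (auto intro!: derivative_intros)
  have prod: "(\<lambda>t. \<Prod>\<beta>\<in>S. (x(\<alpha> := t)) \<beta> ^ k \<beta>) field_differentiable at s" for S k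
  proof (induction S rule: infinite_finite_induct)
    case (insert \<beta> S)
    have "(\<lambda>t. (x(\<alpha> := t)) \<beta> ^ k \<beta> * (\<Prod>\<beta>\<in>S. (x(\<alpha> := t)) \<beta> ^ k \<beta>)) field_differentiable at s"
      by (rule field_differentiable_mult[OF pow insert.IH])
    then show ?case by (simp only: prod.insert[OF insert.hyps])
  qed simp_all
  show ?thesis
    unfolding eval_def
    by (rule field_differentiable_sum) (rule field_differentiable_mult[OF field_differentiable_const prod])
qed

text \<open>The function of s obtained by rescaling x with its coordinate \<alpha> set to s is
  differentiated twice: the chain rule yields the factor \<open>w \<alpha>\<close>, the weight
  identity the factor c.\<close>

lemma partial_derivative_weight:
  assumes weight: "\<And>x. eval P (\<lambda>\<beta>. w \<beta> * x \<beta>) = c * eval P x" and w: "w \<alpha> \<noteq> 0"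
  shows "partial_derivative \<alpha> (eval P) (\<lambda>\<beta>. w \<beta> * x \<beta>) = c / w \<alpha> * partial_derivative \<alpha> (eval P) x"
proof -
  define D where "D = partial_derivative \<alpha> (eval P) (\<lambda>\<beta>. w \<beta> * x \<beta>)"
  define E where "E = partial_derivative \<alpha> (eval P) x"
  have D: "((\<lambda>t. eval P ((\<lambda>\<beta>. w \<beta> * x \<beta>)(\<alpha> := t))) has_field_derivative D) (at (w \<alpha> * x \<alpha>))"
    unfolding D_def partial_derivative_def
    using eval_field_differentiable by (simp add: field_differentiable_derivI)
  have E: "((\<lambda>t. eval P (x(\<alpha> := t))) has_field_derivative E) (at (x \<alpha>))"
    unfolding E_def partial_derivative_def
    using eval_field_differentiable by (simp add: field_differentiable_derivI)
  have "((\<lambda>s. w \<alpha> * s) has_field_derivative w \<alpha>) (at (x \<alpha>))"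
    by (auto intro!: derivative_eq_intros)
  from DERIV_chain2[OF D this]
  have "((\<lambda>s. eval P ((\<lambda>\<beta>. w \<beta> * x \<beta>)(\<alpha> := w \<alpha> * s))) has_field_derivative D * w \<alpha>) (at (x \<alpha>))" .
  also have "(\<lambda>s. eval P ((\<lambda>\<beta>. w \<beta> * x \<beta>)(\<alpha> := w \<alpha> * s))) = (\<lambda>s. c * eval P (x(\<alpha> := s)))"
    (is "?l = ?r")
  proof
    fix s
    have "(\<lambda>\<beta>. w \<beta> * x \<beta>)(\<alpha> := w \<alpha> * s) = (\<lambda>\<beta>. w \<beta> * (x(\<alpha> := s)) \<beta>)" by auto
    then show "?l s = ?r s" by (simp only: weight)
  qed
  finally have "((\<lambda>s. c * eval P (x(\<alpha> := s))) has_field_derivative D * w \<alpha>) (at (x \<alpha>))" .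
  moreover have "((\<lambda>s. c * eval P (x(\<alpha> := s))) has_field_derivative c * E) (at (x \<alpha>))"
    using E by (rule DERIV_cmult)
  ultimately have "D * w \<alpha> = c * E" by (rule DERIV_unique)
  then show ?thesis using w unfolding D_def[symmetric] E_def[symmetric] by (simp add: field_simps)
qed

section \<open>Invariant forms and exponentials of nilpotent elements\<close>

lemma lie_zero_left [simp]: "lie 0 x = (0 :: 'g::complex_lie_algebra)"
  using lie_scale_left[of 0 0 x] by simp

lemma lie_zero_right [simp]: "lie x 0 = (0 :: 'g::complex_lie_algebra)"
  using lie_scale_right[of x 0 0] by simp

lemma lie_antisym: "lie x y = - lie y (x :: 'g::complex_lie_algebra)"
proof -
  have "lie (x + y) (x + y) = lie x y + lie y x"
    by (simp only: lie_add_left lie_add_right lie_self[of x] lie_self[of y]) simp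
  then show ?thesis by (simp add: lie_self eq_neg_iff_add_eq_0)
qed

lemma lie_minus_right: "lie x (- y) = - lie x (y :: 'g::complex_lie_algebra)"
  using lie_scale_right[of x "-1" y] by simp

text \<open>The center is an ideal, and a simple algebra has a nonzero bracket, so the center is not
  everything. This is the faithfulness of the adjoint representation.\<close>

lemma lie_simple_center_trivial:
  assumes simple: "lie_simple (UNIV :: 'g::complex_lie_algebra set)" and z: "\<And>x :: 'g. lie z x = 0"
  shows "z = 0"
proof -
  define C where "C = {c. \<forall>x. lie c x = (0::'g)}"
  have "lie_ideal UNIV C"
    by (auto simp: lie_ideal_def C_def complex_vs.subspace_def lie_add_left lie_scale_left)
      (metis lie_antisym lie_zero_left neg_0_equal_iff_equal)
  then have "C = {0} \<or> C = UNIV" using simple by (auto simp: lie_simple_def)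
  moreover have "C \<noteq> UNIV" using simple by (auto simp: lie_simple_def C_def)
  ultimately show ?thesis using z by (auto simp: C_def)
qed

lemma lie_grade:
  assumes "x \<in> grade H k" "y \<in> grade H l"
  shows "lie x y \<in> grade H (k + l)"
proof -
  have "lie H (lie x y) = lie x (lie H y) - lie y (lie H x)"
    using jacobi[of H x y]
    by (simp add: lie_antisym[of y H] lie_minus_right add_eq_0_iff2 algebra_simps)
  also have "\<dots> = of_int l *\<^sub>C lie x y - of_int k *\<^sub>C lie y x"
    using assms by (simp add: grade_def lie_scale_right)
  also have "\<dots> = of_int (k + l) *\<^sub>C lie x y"
    using lie_antisym[of y x] by (simp add: complex_vs.scale_left_distrib)
  finally show ?thesis by (simp add: grade_def)
qed

text \<open>A filtration instead of single grades: an element of the negative part mixes several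
  grades, so its bracket does not shift the grade by a fixed amount but lowers the filtration by at
  least one.\<close>

definition grade_le :: "'g::complex_lie_algebra \<Rightarrow> int \<Rightarrow> 'g set" where
  "grade_le H n = cspan (\<Union>m\<in>{..n}. grade H m)"

lemma grade_le_mono: "k \<le> n \<Longrightarrow> grade_le H k \<subseteq> grade_le H n"
  unfolding grade_le_def by (rule complex_vs.span_mono) force

text \<open>For homogeneous q and x the grades add up, with that of q at most -1; linearity extends
  this to sums, in x and then in q.\<close>

lemma lie_neg_part_grade_le:
  assumes "q \<in> neg_part H" "x \<in> grade_le H n"
  shows "lie q x \<in> grade_le H (n - 1)"
proof -
  have sub: "csubspace (grade_le H (n - 1))" by (simp add: grade_le_def)
  have step: "grade_le H n \<subseteq> {x. lie q x \<in> grade_le H (n - 1)}" if q: "q \<in> grade H k" "k < 0" for q k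
    unfolding grade_le_def[of H n]
  proof (rule complex_vs.span_minimal)
    show "(\<Union>m\<in>{..n}. grade H m) \<subseteq> {x. lie q x \<in> grade_le H (n - 1)}"
    proof safe
      fix l x assume "l \<le> n" "x \<in> grade H l"
      then have "lie q x \<in> grade H (k + l)" "k + l \<le> n - 1" using lie_grade q by auto
      then show "lie q x \<in> grade_le H (n - 1)"
        unfolding grade_le_def by (intro complex_vs.span_base) auto
    qed
    show "csubspace {x. lie q x \<in> grade_le H (n - 1)}"
      using sub by (auto simp: complex_vs.subspace_def lie_add_right lie_scale_right)
  qed
  have "neg_part H \<subseteq> {q. \<forall>x\<in>grade_le H n. lie q x \<in> grade_le H (n - 1)}"
    unfolding neg_part_def
  proof (rule complex_vs.span_minimal)
    show "(\<Union>m\<in>{..<0}. grade H m) \<subseteq> {q. \<forall>x\<in>grade_le H n. lie q x \<in> grade_le H (n - 1)}"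
      using step by blast
    show "csubspace {q. \<forall>x\<in>grade_le H n. lie q x \<in> grade_le H (n - 1)}"
      using sub by (auto simp: complex_vs.subspace_def lie_add_left lie_scale_left)
  qed
  then show ?thesis using assms by auto
qed

lemma lie_neg_part_funpow:
  assumes "q \<in> neg_part H" "x \<in> grade_le H n"
  shows "(lie q ^^ k) x \<in> grade_le H (n - int k)"
proof (induction k)
  case (Suc k)
  from lie_neg_part_grade_le[OF assms(1) this] show ?case by (simp add: algebra_simps)
qed (use assms in simp)

locale invariant_bilinear =
  fixes B :: "'g::complex_lie_algebra \<Rightarrow> 'g \<Rightarrow> complex"
  assumes form: "invariant_form B"
begin

lemma form_commute: "B x y = B y x"
  and form_add_left: "B (x + y) z = B x z + B y z"
  and form_scale_left: "B (c *\<^sub>C x) y = c * B x y"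
  and form_lie: "B (lie x y) z = B x (lie y z)"
  and form_nondegenerate: "(\<And>y. B x y = 0) \<Longrightarrow> x = 0"
  using form unfolding invariant_form_def by metis+

lemma form_add_right: "B z (x + y) = B z x + B z y"
  and form_scale_right: "B y (c *\<^sub>C x) = c * B y x"
  by (metis form_commute form_add_left, metis form_commute form_scale_left)

lemma form_zero_left [simp]: "B 0 x = 0" and form_zero_right [simp]: "B x 0 = 0"
  using form_scale_left[of 0 0 x] form_scale_right[of x 0 0] by simp_all

lemma form_minus_left: "B (- x) y = - B x y"
  using form_scale_left[of "-1" x y] by simp

lemma form_sum_left: "B (sum f S) x = (\<Sum>i\<in>S. B (f i) x)"
  by (induction S rule: infinite_finite_induct) (auto simp: form_add_left)

lemma form_sum_right: "B x (sum f S) = (\<Sum>i\<in>S. B x (f i))"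
  by (induction S rule: infinite_finite_induct) (auto simp: form_add_right)

lemma grade_bounded_below:
  assumes dual: "dual_bases B I e f UNIV UNIV" and grades: "\<And>i. i \<in> I \<Longrightarrow> \<exists>k. f i \<in> grade H k"
  obtains l where "\<And>k. k < l \<Longrightarrow> grade H k \<subseteq> {0}"
proof -
  obtain g where g: "\<And>i. i \<in> I \<Longrightarrow> f i \<in> grade H (g i)" using grades by metis
  have fin: "finite I" using dual by (simp add: dual_bases_def)
  \<comment> \<open>By invariance, grade k pairs to zero with \<open>f i\<close> unless k = - g i,
    so a number not exceeding any - g i serves as bound; 0 is inserted to keep \<open>Min\<close>
    meaningful for empty I.\<close>
  let ?l = "Min (insert 0 ((\<lambda>i. - g i) ` I))"
  show ?thesis
  proof (rule that[of ?l], safe)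
    fix k x assume k: "k < ?l" and x: "x \<in> grade H k"
    have "B (f i) x = 0" if "i \<in> I" for i
    proof -
      have "of_int k * B (f i) x = B (f i) (lie H x)" using x by (simp add: grade_def form_scale_right)
      also have "\<dots> = - B (lie H (f i)) x"
        by (simp add: lie_antisym[of H "f i"] form_minus_left form_lie)
      also have "\<dots> = - of_int (g i) * B (f i) x"
        using g[OF that] by (simp add: grade_def form_scale_left)
      finally have "of_int (k + g i) * B (f i) x = 0" by (simp add: algebra_simps)
      moreover have "?l \<le> - g i" using fin that by (intro Min_le) auto
      ultimately show ?thesis using k by (metis mult_eq_0_iff of_int_eq_0_iff add_less_zeroD
        add.commute less_le_trans eq_neg_iff_add_eq_0 less_irrefl)
    qed
    then have "x = 0"
      using dual_basis_expansion[OF form dual_bases_commute[OF form dual], of x] by simp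
    then show "x = 0" .
  qed
qed

text \<open>Since the grades span, x has some filtration degree; each bracket with q lowers it, and
  the grades are bounded below.\<close>

lemma neg_part_nilpotent:
  assumes dual: "dual_bases B I e f UNIV UNIV" and grades: "\<And>i. i \<in> I \<Longrightarrow> \<exists>k. f i \<in> grade H k"
    and gradation: "integer_gradation H" and q: "q \<in> neg_part H"
  obtains n where "\<And>k. k \<ge> n \<Longrightarrow> (lie q ^^ k) x = 0"
proof -
  obtain l where l: "\<And>k. k < l \<Longrightarrow> grade H k \<subseteq> {0}"
    using grade_bounded_below[OF dual grades] by blast
  have "cspan (\<Union>m. grade H m) \<subseteq> {x. \<exists>n. x \<in> grade_le H n}"
  proof (rule complex_vs.span_minimal)
    show "(\<Union>m. grade H m) \<subseteq> {x. \<exists>n. x \<in> grade_le H n}"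
      by (auto simp: grade_le_def intro!: complex_vs.span_base)
    have "x + y \<in> grade_le H (max n n')" if "x \<in> grade_le H n" "y \<in> grade_le H n'" for x y n n'
      using that grade_le_mono[of n "max n n'" H] grade_le_mono[of n' "max n n'" H]
      unfolding grade_le_def by (intro complex_vs.span_add) auto
    then show "csubspace {x. \<exists>n. x \<in> grade_le H n}"
      unfolding complex_vs.subspace_def
      by (auto simp: grade_le_def complex_vs.span_zero intro: complex_vs.span_scale) blast
  qed
  then obtain n where n: "x \<in> grade_le H n"
    using gradation by (auto simp: integer_gradation_def)
  \<comment> \<open>This bound on k is exactly n - k < l, where only the zero vector
    remains.\<close>
  have "(lie q ^^ k) x = 0" if "k \<ge> nat (n - l + 1)" for k
  proof -
    have "(lie q ^^ k) x \<in> grade_le H (n - int k)"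
      using lie_neg_part_funpow[OF q n] .
    also have "grade_le H (n - int k) \<subseteq> cspan {0}"
      unfolding grade_le_def using l that by (intro complex_vs.span_mono) force
    finally show ?thesis by simp
  qed
  then show ?thesis by (rule that)
qed

end

lemma exp_ad_scale: "exp_ad q (c *\<^sub>C x) = c *\<^sub>C exp_ad q x"
proof -
  have "(lie q ^^ k) (c *\<^sub>C x) = c *\<^sub>C (lie q ^^ k) x" for k
    by (induction k) (auto simp: lie_scale_right)
  then show ?thesis
    by (simp add: exp_ad_def cscale_Sum_any cscale_cscale mult.commute)
qed

text \<open>Nilpotency enters here: \<open>Sum_any\<close> splits over a sum of two families once
  both have finite support.\<close>

lemma exp_ad_add:
  assumes "\<And>x. \<exists>n. \<forall>k\<ge>n. (lie q ^^ k) x = 0"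
  shows "exp_ad q (x + y) = exp_ad q x + exp_ad q y"
proof -
  have fin: "finite {k. (1 / fact k) *\<^sub>C (lie q ^^ k) x \<noteq> 0}" for x
  proof -
    obtain n where "\<forall>k\<ge>n. (lie q ^^ k) x = 0" using assms by blast
    then have "{k. (1 / fact k) *\<^sub>C (lie q ^^ k) x \<noteq> 0} \<subseteq> {..<n}"
      by (force simp: not_less[symmetric])
    then show ?thesis by (rule finite_subset) simp
  qed
  have "(lie q ^^ k) (x + y) = (lie q ^^ k) x + (lie q ^^ k) y" for k
    by (induction k) (auto simp: lie_add_right)
  then show ?thesis
    unfolding exp_ad_def complex_vs.scale_right_distrib
    by (simp add: complex_vs.scale_right_distrib Sum_any.distrib[OF fin fin])
qed

lemma exp_ad_sum:
  assumes "\<And>x. \<exists>n. \<forall>k\<ge>n. (lie q ^^ k) x = 0"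
  shows "exp_ad q (\<Sum>i\<in>S. c i *\<^sub>C x i) = (\<Sum>i\<in>S. c i *\<^sub>C exp_ad q (x i))"
proof (induction S rule: infinite_finite_induct)
  case (insert i S)
  then show ?case by (simp add: exp_ad_add[OF assms] exp_ad_scale)
qed (use exp_ad_scale[of q 0 0] in simp_all)

section \<open>Automorphisms that preserve the form\<close>

locale equivariant_form = invariant_bilinear B
  for B :: "'g::complex_lie_algebra \<Rightarrow> 'g \<Rightarrow> complex" +
  fixes \<tau> :: "'g \<Rightarrow> 'g"
  assumes automorphism: "lie_automorphism \<tau>" and form_tau: "B (\<tau> x) (\<tau> y) = B x y"
begin

lemma tau_linear: "clinear \<tau>" and tau_inj: "inj \<tau>" and tau_surj: "surj \<tau>"
  and tau_lie: "\<tau> (lie x y) = lie (\<tau> x) (\<tau> y)"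
  using automorphism by (auto simp: lie_automorphism_def bij_def)

lemmas tau_scale = complex_vs_pair.linear_scale[OF tau_linear]
lemmas tau_sum = complex_vs_pair.linear_sum[OF tau_linear]
lemmas tau_neg = complex_vs_pair.linear_neg[OF tau_linear]

lemma tau_exp_ad: "\<tau> (exp_ad q x) = exp_ad (\<tau> q) (\<tau> x)"
proof -
  have "\<tau> ((lie q ^^ k) x) = (lie (\<tau> q) ^^ k) (\<tau> x)" for k
    by (induction k) (auto simp: tau_lie)
  then show ?thesis
    by (simp add: exp_ad_def clinear_Sum_any[OF tau_linear tau_inj] tau_scale)
qed

lemma form_eigenvector: "\<tau> x = a *\<^sub>C x \<Longrightarrow> a * B x (\<tau> y) = B x y"
  by (metis form_scale_left form_tau)

lemma dual_eigenvalues: "\<tau> x = a *\<^sub>C x \<Longrightarrow> \<tau> y = b *\<^sub>C y \<Longrightarrow> B x y = 1 \<Longrightarrow> a * b = 1"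
  by (metis form_eigenvector form_scale_right mult.right_neutral)

lemma tau_neg_element:
  assumes "\<And>\<alpha>. \<alpha> < m \<Longrightarrow> \<tau> (L \<alpha>) = w \<alpha> *\<^sub>C L \<alpha>"
  shows "\<tau> (neg_element m L x) = neg_element m L (\<lambda>\<alpha>. w \<alpha> * x \<alpha>)"
  unfolding neg_element_def tau_sum tau_scale
  by (intro sum.cong) (auto simp: assms cscale_cscale mult.commute)

lemma exp_ad_weight:
  assumes L: "\<And>\<alpha>. \<alpha> < m \<Longrightarrow> \<tau> (L \<alpha>) = w \<alpha> *\<^sub>C L \<alpha>"
    and x: "\<tau> x = c *\<^sub>C x" "c \<noteq> 0"
  shows "exp_ad (- neg_element m L (\<lambda>\<alpha>. w \<alpha> * q \<alpha>)) x
    = (1 / c) *\<^sub>C \<tau> (exp_ad (- neg_element m L q) x)"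
proof -
  have "\<tau> (exp_ad (- neg_element m L q) x)
      = c *\<^sub>C exp_ad (- neg_element m L (\<lambda>\<alpha>. w \<alpha> * q \<alpha>)) x"
    by (simp only: tau_exp_ad tau_neg tau_neg_element[OF L] x exp_ad_scale)
  then show ?thesis using x(2) by (simp add: cscale_cscale cscale_one)
qed

text \<open>The factor 1 / c comes from x, the factor 1 / a from moving \<tau> onto t by invariance
  of the form. This one computation yields the weights of \<open>\<U>\<close>, \<open>\<L>\<close>
  and of the combinations of \<open>\<D>\<close>.\<close>

lemma exp_ad_pairing_weight:
  assumes L: "\<And>\<alpha>. \<alpha> < m \<Longrightarrow> \<tau> (L \<alpha>) = w \<alpha> *\<^sub>C L \<alpha>"
    and x: "\<tau> x = c *\<^sub>C x" "c \<noteq> 0" and t: "\<tau> t = a *\<^sub>C t" "a \<noteq> 0"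
  shows "B t (exp_ad (- neg_element m L (\<lambda>\<alpha>. w \<alpha> * q \<alpha>)) x)
    = 1 / (c * a) * B t (exp_ad (- neg_element m L q) x)"
proof -
  have "B t (exp_ad (- neg_element m L (\<lambda>\<alpha>. w \<alpha> * q \<alpha>)) x)
      = 1 / c * B t (\<tau> (exp_ad (- neg_element m L q) x))"
    by (simp only: exp_ad_weight[OF L x] form_scale_right)
  also have "B t (\<tau> (exp_ad (- neg_element m L q) x)) = 1 / a * B t (exp_ad (- neg_element m L q) x)"
    using form_eigenvector[OF t(1), of "exp_ad (- neg_element m L q) x"] t(2)
    by (simp add: nonzero_eq_divide_eq mult.commute)
  finally show ?thesis by simp
qed

text \<open>Replacing \<open>q\<close> by \<open>\<tau> q\<close> rescales the coordinate \<open>q\<^sup>\<alpha>\<close> by \<open>w \<alpha>\<close>, hence the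
  derivative with respect to it by \<open>1 / w \<alpha>\<close>; since the adjoint representation is faithful, this determines
  the behaviour of \<open>\<Phi>\<close>.\<close>

lemma Phi_weight:
  assumes simple: "lie_simple (UNIV :: 'g set)"
    and dual: "dual_bases B {..<m} L U V W"
    and L: "\<And>\<alpha>. \<alpha> < m \<Longrightarrow> \<tau> (L \<alpha>) = w \<alpha> *\<^sub>C L \<alpha>" and w: "\<And>\<alpha>. \<alpha> < m \<Longrightarrow> w \<alpha> \<noteq> 0"
    and \<Phi>: "\<And>\<alpha> x X Y. \<alpha> < m \<Longrightarrow>
        ((\<lambda>t. B (exp_ad (neg_element m L (x(\<alpha> := t))) (exp_ad (- neg_element m L x) X)) Y)
          has_field_derivative B (lie (\<Sum>\<beta><m. \<phi> \<alpha> \<beta> x *\<^sub>C L \<beta>) X) Y) (at (x \<alpha>))"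
    and \<alpha>: "\<alpha> < m" and \<beta>: "\<beta> < m"
  shows "\<phi> \<alpha> \<beta> (\<lambda>\<gamma>. w \<gamma> * x \<gamma>) = w \<beta> / w \<alpha> * \<phi> \<alpha> \<beta> x"
proof -
  let ?wx = "\<lambda>\<gamma>. w \<gamma> * x \<gamma>"
  let ?n = "neg_element m L"
  \<comment> \<open>Both come from the coefficients of \<Phi>: Z is \<open>w \<alpha>\<close> times
    the element at the rescaled point, \<open>Z'\<close> is the image under \<tau> of the element at
    x. Their equality is the claim, read in coordinates.\<close>
  define Z where "Z = (\<Sum>\<beta><m. (w \<alpha> * \<phi> \<alpha> \<beta> ?wx) *\<^sub>C L \<beta>)"
  define Z' where "Z' = (\<Sum>\<beta><m. (w \<beta> * \<phi> \<alpha> \<beta> x) *\<^sub>C L \<beta>)"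
  have Z: "Z = w \<alpha> *\<^sub>C (\<Sum>\<beta><m. \<phi> \<alpha> \<beta> ?wx *\<^sub>C L \<beta>)"
    by (simp add: Z_def complex_vs.scale_sum_right cscale_cscale)
  have Z': "Z' = \<tau> (\<Sum>\<beta><m. \<phi> \<alpha> \<beta> x *\<^sub>C L \<beta>)"
    unfolding Z'_def tau_sum tau_scale by (intro sum.cong) (auto simp: L cscale_cscale mult.commute)
  have "lie Z X = lie Z' X" for X
  proof -
    \<comment> \<open>The Lie algebra has no topology, so only matrix elements are differentiated;
      nondegeneracy then removes Y.\<close>
    have "B (lie Z X) Y = B (lie Z' X) Y" for Y
    proof -
      obtain X' Y' where X': "X = \<tau> X'" and Y': "Y = \<tau> Y'" using tau_surj by (metis surjD)
      have "((\<lambda>s. w \<alpha> * s) has_field_derivative w \<alpha>) (at (x \<alpha>))"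
        by (auto intro!: derivative_eq_intros)
      from DERIV_chain2[OF \<Phi>[OF \<alpha>, of ?wx X Y] this]
      have "((\<lambda>s. B (exp_ad (?n (?wx(\<alpha> := w \<alpha> * s))) (exp_ad (- ?n ?wx) X)) Y)
          has_field_derivative B (lie (\<Sum>\<beta><m. \<phi> \<alpha> \<beta> ?wx *\<^sub>C L \<beta>) X) Y * w \<alpha>) (at (x \<alpha>))" .
      moreover have "B (lie (\<Sum>\<beta><m. \<phi> \<alpha> \<beta> ?wx *\<^sub>C L \<beta>) X) Y * w \<alpha> = B (lie Z X) Y"
        by (simp add: Z lie_scale_left form_scale_left)
      \<comment> \<open>Rescaling the point amounts to applying \<tau>, and with X and Y written as
        images the isometry cancels \<tau> everywhere.\<close>
      moreover have "B (exp_ad (?n (?wx(\<alpha> := w \<alpha> * s))) (exp_ad (- ?n ?wx) X)) Y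
          = B (exp_ad (?n (x(\<alpha> := s))) (exp_ad (- ?n x) X')) Y'" for s
      proof -
        have "?wx(\<alpha> := w \<alpha> * s) = (\<lambda>\<gamma>. w \<gamma> * (x(\<alpha> := s)) \<gamma>)" by auto
        then have n: "?n (?wx(\<alpha> := w \<alpha> * s)) = \<tau> (?n (x(\<alpha> := s)))" "?n ?wx = \<tau> (?n x)"
          by (simp_all only: tau_neg_element[OF L])
        show ?thesis
          unfolding n X' Y' tau_neg[symmetric] tau_exp_ad[symmetric] form_tau ..
      qed
      ultimately have "((\<lambda>s. B (exp_ad (?n (x(\<alpha> := s))) (exp_ad (- ?n x) X')) Y')
          has_field_derivative B (lie Z X) Y) (at (x \<alpha>))"
        by (simp only:)
      from DERIV_unique[OF this \<Phi>[OF \<alpha>]]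
      have "B (lie Z X) Y = B (lie (\<Sum>\<beta><m. \<phi> \<alpha> \<beta> x *\<^sub>C L \<beta>) X') Y'" .
      also have "\<dots> = B (lie Z' X) Y"
        unfolding Z' X' Y' tau_lie[symmetric] form_tau ..
      finally show ?thesis .
    qed
    then have "B (lie Z X - lie Z' X) Y = 0" for Y
      using form_add_left[of "lie Z X - lie Z' X" "lie Z' X" Y] by simp
    then show ?thesis using form_nondegenerate by fastforce
  qed
  then have "lie (Z - Z') X = 0" for X
    using lie_add_left[of "Z - Z'" Z' X] by simp
  then have "Z = Z'" using lie_simple_center_trivial[OF simple] by fastforce
  moreover have "B (U \<beta>) Z = w \<alpha> * \<phi> \<alpha> \<beta> ?wx"
    unfolding Z_def using \<beta> by (intro dual_basis_coefficient[OF form dual_bases_commute[OF form dual]]) auto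
  moreover have "B (U \<beta>) Z' = w \<beta> * \<phi> \<alpha> \<beta> x"
    unfolding Z'_def using \<beta> by (intro dual_basis_coefficient[OF form dual_bases_commute[OF form dual]]) auto
  ultimately show ?thesis using w[OF \<alpha>] by (simp add: field_simps)
qed

end

text \<open>Passing to the rescaled point conjugates \<phi> by the diagonal matrix of the w. The
  conjugate of \<psi> is then a right inverse there, and right inverses are unique.\<close>

lemma Psi_weight:
  fixes \<phi> \<psi> :: "nat \<Rightarrow> nat \<Rightarrow> (nat \<Rightarrow> complex) \<Rightarrow> complex"
  assumes \<phi>: "\<And>\<alpha> \<beta> x. \<alpha> < m \<Longrightarrow> \<beta> < m \<Longrightarrow> \<phi> \<alpha> \<beta> (\<lambda>\<gamma>. w \<gamma> * x \<gamma>) = w \<beta> / w \<alpha> * \<phi> \<alpha> \<beta> x"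
    and inverse: "\<And>\<alpha> \<gamma> x. \<alpha> < m \<Longrightarrow> \<gamma> < m \<Longrightarrow>
        (\<Sum>\<beta><m. \<phi> \<alpha> \<beta> x * \<psi> \<beta> \<gamma> x) = (if \<alpha> = \<gamma> then 1 else 0)"
    and w: "\<And>\<alpha>. \<alpha> < m \<Longrightarrow> w \<alpha> \<noteq> 0"
    and \<alpha>: "\<alpha> < m" and \<beta>: "\<beta> < m"
  shows "\<psi> \<alpha> \<beta> (\<lambda>\<gamma>. w \<gamma> * x \<gamma>) = w \<beta> / w \<alpha> * \<psi> \<alpha> \<beta> x"
proof -
  let ?wx = "\<lambda>\<gamma>. w \<gamma> * x \<gamma>"
  have "(\<Sum>j<m. \<phi> i j ?wx * (w k / w j * \<psi> j k x)) = (if i = k then 1 else 0)"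
    if "i < m" "k < m" for i k
  proof -
    have "(\<Sum>j<m. \<phi> i j ?wx * (w k / w j * \<psi> j k x)) = (\<Sum>j<m. w k / w i * (\<phi> i j x * \<psi> j k x))"
      using w that by (intro sum.cong) (auto simp: \<phi> field_simps)
    also have "\<dots> = w k / w i * (if i = k then 1 else 0)"
      using inverse[OF that] by (simp only: flip: sum_distrib_left)
    finally show ?thesis using w that by auto
  qed
  from right_inverse_unique_square[OF inverse[of _ _ ?wx] this \<alpha> \<beta>] show ?thesis by simp
qed

section \<open>Fields of definite weight\<close>

text \<open>Weaker than linearity on purpose: compatibility with scalars is inherited by every
  \<open>fld_mult\<close>, whatever the support of its sum.\<close>

definition homogeneous_field :: "'v::complex_vector_space fld \<Rightarrow> bool" where
  "homogeneous_field \<phi> \<longleftrightarrow> (\<forall>n c v. \<phi> n (c *\<^sub>C v) = c *\<^sub>C \<phi> n v)"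

text \<open>Conjugation by \<tau> multiplies the field by c, written without an inverse of
  \<tau>.\<close>

definition weighted_field ::
    "('v::complex_vector_space \<Rightarrow> 'v) \<Rightarrow> complex \<Rightarrow> 'v fld \<Rightarrow> bool" where
  "weighted_field \<tau> c \<phi> \<longleftrightarrow> (\<forall>n v. \<tau> (\<phi> n v) = c *\<^sub>C \<phi> n (\<tau> v))"

lemma homogeneous_fld_one: "homogeneous_field fld_one"
  by (simp add: homogeneous_field_def fld_one_def)

lemma homogeneous_fld_mult:
  "homogeneous_field \<phi> \<Longrightarrow> homogeneous_field \<psi> \<Longrightarrow> homogeneous_field (fld_mult \<phi> \<psi>)"
  by (simp add: homogeneous_field_def fld_mult_def cscale_Sum_any)

lemma homogeneous_monomial_field:
  assumes "\<And>\<alpha>. \<alpha> \<in> Poly_Mapping.keys e \<Longrightarrow> homogeneous_field (q \<alpha>)"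
  shows "homogeneous_field (monomial_field q e)"
proof -
  have "homogeneous_field (foldr fld_mult \<phi>s fld_one)" if "\<forall>\<phi>\<in>set \<phi>s. homogeneous_field \<phi>" for \<phi>s :: "'a fld list"
    using that by (induction \<phi>s) (auto simp: homogeneous_fld_one homogeneous_fld_mult)
  then show ?thesis unfolding monomial_field_def using assms by auto
qed

lemma homogeneous_fld_minus: "homogeneous_field \<phi> \<Longrightarrow> homogeneous_field (fld_minus \<phi>)"
  by (simp add: homogeneous_field_def fld_minus_def)

lemma homogeneous_fld_plus: "homogeneous_field \<phi> \<Longrightarrow> homogeneous_field (fld_plus \<phi>)"
  using homogeneous_fld_minus[of \<phi>]
  by (simp add: homogeneous_field_def fld_plus_def complex_vs.scale_right_diff_distrib)

lemma homogeneous_poly_field: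
  assumes "mpoly_in m P" "\<And>\<alpha>. \<alpha> < m \<Longrightarrow> homogeneous_field (q \<alpha>)"
  shows "homogeneous_field (poly_field q P)"
proof -
  have "homogeneous_field (monomial_field q e)" if "e \<in> Poly_Mapping.keys P" for e
    using assms that by (intro homogeneous_monomial_field) (auto simp: mpoly_in_def)
  then show ?thesis
    by (auto simp: homogeneous_field_def poly_field_def complex_vs.scale_sum_right cscale_cscale
        mult.commute intro!: sum.cong)
qed

lemma homogeneous_sum_field:
  "(\<And>i. i \<in> S \<Longrightarrow> homogeneous_field (\<phi> i)) \<Longrightarrow> homogeneous_field (\<lambda>n v. \<Sum>i\<in>S. \<phi> i n v)"
  by (auto simp: homogeneous_field_def complex_vs.scale_sum_right intro!: sum.cong)

lemma homogeneous_add_field: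
  "homogeneous_field \<phi> \<Longrightarrow> homogeneous_field \<psi> \<Longrightarrow> homogeneous_field (\<lambda>n v. \<phi> n v + \<psi> n v)"
  by (simp add: homogeneous_field_def complex_vs.scale_right_distrib)

lemma homogeneous_cscale_field:
  "homogeneous_field \<phi> \<Longrightarrow> homogeneous_field (\<lambda>n v. k *\<^sub>C \<phi> n v)"
  by (simp add: homogeneous_field_def cscale_cscale mult.commute)

lemma weighted_fieldD: "weighted_field \<tau> c \<phi> \<Longrightarrow> \<tau> (\<phi> n v) = c *\<^sub>C \<phi> n (\<tau> v)"
  by (simp add: weighted_field_def)

locale injective_linear =
  fixes \<tau> :: "'v::complex_vector_space \<Rightarrow> 'v"
  assumes linear_tau: "clinear \<tau>" and inj_tau: "inj \<tau>"
begin

lemmas tau_simps = complex_vs_pair.linear_scale[OF linear_tau] complex_vs_pair.linear_sum[OF linear_tau]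
  complex_vs_pair.linear_add[OF linear_tau] complex_vs_pair.linear_diff[OF linear_tau]
  complex_vs_pair.linear_neg[OF linear_tau] complex_vs_pair.linear_0[OF linear_tau]

lemma weighted_fld_one: "weighted_field \<tau> 1 fld_one"
  by (simp add: weighted_field_def fld_one_def tau_simps)

text \<open>Injectivity carries \<tau> through the sum; homogeneity of the left factor moves the
  constant b of \<psi> out of \<phi>.\<close>

lemma weighted_fld_mult:
  assumes "homogeneous_field \<phi>" "weighted_field \<tau> a \<phi>" "weighted_field \<tau> b \<psi>"
  shows "weighted_field \<tau> (a * b) (fld_mult \<phi> \<psi>)"
  using assms
  by (simp add: weighted_field_def homogeneous_field_def fld_mult_def
      clinear_Sum_any[OF linear_tau inj_tau] cscale_Sum_any cscale_cscale)

lemma weighted_fld_minus: "weighted_field \<tau> a \<phi> \<Longrightarrow> weighted_field \<tau> a (fld_minus \<phi>)"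
  by (simp add: weighted_field_def fld_minus_def tau_simps)

lemma weighted_fld_plus: "weighted_field \<tau> a \<phi> \<Longrightarrow> weighted_field \<tau> a (fld_plus \<phi>)"
  by (simp add: weighted_field_def fld_plus_def fld_minus_def tau_simps
      complex_vs.scale_right_diff_distrib)

lemma weighted_add_field:
  "weighted_field \<tau> a \<phi> \<Longrightarrow> weighted_field \<tau> a \<psi> \<Longrightarrow> weighted_field \<tau> a (\<lambda>n v. \<phi> n v + \<psi> n v)"
  by (simp add: weighted_field_def tau_simps complex_vs.scale_right_distrib)

lemma weighted_cscale_field:
  "weighted_field \<tau> a \<phi> \<Longrightarrow> weighted_field \<tau> a (\<lambda>n v. k *\<^sub>C \<phi> n v)"
  by (simp add: weighted_field_def tau_simps cscale_cscale mult.commute)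

lemma weighted_sum_field:
  "(\<And>i. i \<in> S \<Longrightarrow> weighted_field \<tau> a (\<phi> i)) \<Longrightarrow> weighted_field \<tau> a (\<lambda>n v. \<Sum>i\<in>S. \<phi> i n v)"
  by (auto simp: weighted_field_def tau_simps complex_vs.scale_sum_right intro!: sum.cong)

lemma weighted_fld_deriv: "weighted_field \<tau> a \<phi> \<Longrightarrow> weighted_field \<tau> a (fld_deriv \<phi>)"
  by (simp add: weighted_field_def fld_deriv_def tau_simps cscale_cscale mult.commute)

text \<open>The two halves multiply in opposite orders, so each of \<phi> and \<psi> is once the
  left factor and has to be homogeneous.\<close>

lemma weighted_normal_ordered:
  assumes "homogeneous_field \<phi>" "homogeneous_field \<psi>" "weighted_field \<tau> a \<phi>" "weighted_field \<tau> b \<psi>"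
  shows "weighted_field \<tau> (a * b) (normal_ordered \<phi> \<psi>)"
proof -
  have "weighted_field \<tau> (a * b) (fld_mult (fld_plus \<phi>) \<psi>)"
    using assms by (intro weighted_fld_mult homogeneous_fld_plus weighted_fld_plus)
  moreover have "weighted_field \<tau> (b * a) (fld_mult \<psi> (fld_minus \<phi>))"
    using assms by (intro weighted_fld_mult weighted_fld_minus)
  ultimately have "weighted_field \<tau> (a * b) (\<lambda>n v. fld_mult (fld_plus \<phi>) \<psi> n v + fld_mult \<psi> (fld_minus \<phi>) n v)"
    by (intro weighted_add_field) (simp_all add: mult.commute)
  then show ?thesis by (simp add: weighted_field_def normal_ordered_def)
qed

lemma weighted_monomial_field:
  assumes q: "\<And>\<alpha>. \<alpha> \<in> Poly_Mapping.keys e \<Longrightarrow> homogeneous_field (q \<alpha>)"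
    "\<And>\<alpha>. \<alpha> \<in> Poly_Mapping.keys e \<Longrightarrow> weighted_field \<tau> (w \<alpha>) (q \<alpha>)"
  shows "weighted_field \<tau> (monom_value e w) (monomial_field q e)"
proof -
  have rep: "weighted_field \<tau> (a ^ n * b) ((fld_mult \<phi> ^^ n) \<psi>)"
    if "homogeneous_field \<phi>" "weighted_field \<tau> a \<phi>" "weighted_field \<tau> b \<psi>" for n a b \<phi> \<psi>
  proof (induction n)
    case (Suc n)
    from weighted_fld_mult[OF that(1,2) this] show ?case by (simp add: mult.assoc)
  qed (use that in simp)
  have "weighted_field \<tau> (\<Prod>\<alpha>\<leftarrow>\<alpha>s. w \<alpha> ^ Poly_Mapping.lookup e \<alpha>)
      (foldr fld_mult (concat (map (\<lambda>\<alpha>. replicate (Poly_Mapping.lookup e \<alpha>) (q \<alpha>)) \<alpha>s)) fld_one)"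
    if "set \<alpha>s \<subseteq> Poly_Mapping.keys e" for \<alpha>s
    using that by (induction \<alpha>s) (auto intro!: rep q simp: weighted_fld_one)
  from this[of "sorted_list_of_set (Poly_Mapping.keys e)"] show ?thesis
    unfolding monomial_field_def monom_value_def
    by (subst prod.distinct_set_conv_list[of "sorted_list_of_set (Poly_Mapping.keys e)", simplified])
      simp_all
qed

text \<open>Stated for a combination because the single \<open>P i\<close> may have no weight.
  Monomials can cancel between them, so the coefficients \<open>f e\<close> are collected first. The
  point is rescaled by w, whereas the fields have the inverse weights \<open>w'\<close>.\<close>

lemma weighted_poly_combination:
  fixes P :: "'i \<Rightarrow> mpoly"
  assumes I: "finite I" and P: "\<And>i. i \<in> I \<Longrightarrow> mpoly_in m (P i)"
    and q: "\<And>\<alpha>. \<alpha> < m \<Longrightarrow> homogeneous_field (q \<alpha>)" "\<And>\<alpha>. \<alpha> < m \<Longrightarrow> weighted_field \<tau> (w' \<alpha>) (q \<alpha>)"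
    and w: "\<And>\<alpha>. \<alpha> < m \<Longrightarrow> w \<alpha> * w' \<alpha> = 1"
    and weight: "\<And>x. (\<Sum>i\<in>I. c i * eval (P i) (\<lambda>\<alpha>. w \<alpha> * x \<alpha>)) = b * (\<Sum>i\<in>I. c i * eval (P i) x)"
  shows "weighted_field \<tau> (1 / b) (\<lambda>n v. \<Sum>i\<in>I. c i *\<^sub>C poly_field q (P i) n v)"
proof -
  define E where "E = (\<Union>i\<in>I. Poly_Mapping.keys (P i))"
  define f where "f e = (\<Sum>i\<in>I. c i * Poly_Mapping.lookup (P i) e)" for e
  have E: "finite E" "\<And>i. i \<in> I \<Longrightarrow> Poly_Mapping.keys (P i) \<subseteq> E" using I by (auto simp: E_def)
  have eval: "(\<Sum>i\<in>I. c i * eval (P i) x) = (\<Sum>e\<in>E. f e * monom_value e x)" for x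
  proof -
    have "eval (P i) x = (\<Sum>e\<in>E. Poly_Mapping.lookup (P i) e * monom_value e x)" if "i \<in> I" for i
      unfolding eval_monom_value using E that
      by (intro sum.mono_neutral_left) (auto simp: in_keys_iff)
    then have "(\<Sum>i\<in>I. c i * eval (P i) x)
        = (\<Sum>i\<in>I. \<Sum>e\<in>E. c i * Poly_Mapping.lookup (P i) e * monom_value e x)"
      by (auto simp: sum_distrib_left mult.assoc intro!: sum.cong)
    then show ?thesis by (subst (asm) sum.swap) (simp add: f_def sum_distrib_right)
  qed
  have field: "(\<Sum>i\<in>I. c i *\<^sub>C poly_field q (P i) n v) = (\<Sum>e\<in>E. f e *\<^sub>C monomial_field q e n v)" for n v
  proof -
    have "poly_field q (P i) n v = (\<Sum>e\<in>E. Poly_Mapping.lookup (P i) e *\<^sub>C monomial_field q e n v)"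
      if "i \<in> I" for i
      unfolding poly_field_def using E that
      by (intro sum.mono_neutral_left) (auto simp: in_keys_iff)
    then have "(\<Sum>i\<in>I. c i *\<^sub>C poly_field q (P i) n v)
        = (\<Sum>i\<in>I. \<Sum>e\<in>E. (c i * Poly_Mapping.lookup (P i) e) *\<^sub>C monomial_field q e n v)"
      by (auto simp: complex_vs.scale_sum_right cscale_cscale intro!: sum.cong)
    then show ?thesis by (subst (asm) sum.swap) (simp add: f_def complex_vs.scale_sum_left)
  qed
  show ?thesis
    unfolding field
  proof (intro weighted_sum_field)
    fix e assume e: "e \<in> E"
    show "weighted_field \<tau> (1 / b) (\<lambda>n v. f e *\<^sub>C monomial_field q e n v)"
    proof (cases "f e = 0")
      case True
      then show ?thesis by (simp add: weighted_field_def tau_simps)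
    next
      case False
      have keys: "Poly_Mapping.keys e \<subseteq> {..<m}" using e P by (auto simp: E_def mpoly_in_def)
      have "monom_value e w = b"
        using monom_value_weight[of E f w b e] E(1) e False weight by (simp add: eval)
      \<comment> \<open>A surviving monomial has an invertible weight, so b is nonzero here.\<close>
      then have "b * monom_value e w' = 1"
        using monom_value_inverse_weight[of e m w w', OF keys w] by simp
      then have "monom_value e w' = 1 / b" by (auto simp: eq_divide_eq mult.commute)
      moreover have "weighted_field \<tau> (monom_value e w') (monomial_field q e)"
        using keys q by (intro weighted_monomial_field) auto
      ultimately show ?thesis by (simp add: weighted_cscale_field)
    qed
  qed
qed

lemma weighted_poly_field:
  assumes "mpoly_in m P"
    and q: "\<And>\<alpha>. \<alpha> < m \<Longrightarrow> homogeneous_field (q \<alpha>)" "\<And>\<alpha>. \<alpha> < m \<Longrightarrow> weighted_field \<tau> (w' \<alpha>) (q \<alpha>)"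
    and "\<And>\<alpha>. \<alpha> < m \<Longrightarrow> w \<alpha> * w' \<alpha> = 1"
    and "\<And>x. eval P (\<lambda>\<alpha>. w \<alpha> * x \<alpha>) = b * eval P x"
  shows "weighted_field \<tau> (1 / b) (poly_field q P)"
proof -
  have "weighted_field \<tau> (1 / b) (\<lambda>n v. \<Sum>i\<in>{()}. 1 *\<^sub>C poly_field q P n v)"
    using assms by (intro weighted_poly_combination[of _ m _ _ w' w]) simp_all
  then show ?thesis by (simp add: weighted_field_def)
qed

end

text \<open>On S such a field has only negative modes, like a power series in z. Stability of S
  allows this to be used for iterated products.\<close>

definition creation_only_on :: "'v::complex_vector_space set \<Rightarrow> 'v fld \<Rightarrow> bool" where
  "creation_only_on S \<phi> \<longleftrightarrow> (\<forall>v\<in>S. \<forall>n. \<phi> n v \<in> S \<and> (n \<ge> 0 \<longrightarrow> \<phi> n v = 0))"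

lemma creation_only_fld_mult:
  assumes S: "csubspace S" and \<phi>: "creation_only_on S \<phi>" and \<psi>: "creation_only_on S \<psi>"
    and zero: "\<And>n. \<phi> n 0 = 0"
  shows "creation_only_on S (fld_mult \<phi> \<psi>)"
  unfolding creation_only_on_def
proof (intro ballI allI conjI impI)
  fix v n assume v: "v \<in> S"
  then show "fld_mult \<phi> \<psi> n v \<in> S"
    using S \<phi> \<psi> unfolding fld_mult_def Sum_any.expand_set
    by (intro complex_vs.subspace_sum) (auto simp: creation_only_on_def)
  assume n: "n \<ge> 0"
  \<comment> \<open>The indices k and n - k - 1 add up to n - 1 \<ge> -1, so they are not both
    negative.\<close>
  have "\<phi> k (\<psi> (n - k - 1) v) = 0" for k
    using \<phi> \<psi> v n zero by (cases "k \<ge> 0") (auto simp: creation_only_on_def)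
  then show "fld_mult \<phi> \<psi> n v = 0" by (simp add: fld_mult_def)
qed

lemma creation_only_poly_field:
  assumes S: "csubspace S" and P: "mpoly_in m P" and q: "\<And>\<alpha>. \<alpha> < m \<Longrightarrow> creation_only_on S (q \<alpha>)"
    and zero: "\<And>\<alpha> n. \<alpha> < m \<Longrightarrow> q \<alpha> n 0 = 0"
  shows "creation_only_on S (poly_field q P)"
proof -
  have list: "creation_only_on S (foldr fld_mult \<phi>s fld_one)"
    if "\<forall>\<phi>\<in>set \<phi>s. creation_only_on S \<phi> \<and> (\<forall>n. \<phi> n 0 = 0)" for \<phi>s
    using that
  proof (induction \<phi>s)
    case Nil
    then show ?case
      using complex_vs.subspace_0[OF S] by (auto simp: creation_only_on_def fld_one_def)
  qed (auto intro!: creation_only_fld_mult[OF S])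
  have "creation_only_on S (monomial_field q e)" if "e \<in> Poly_Mapping.keys P" for e
    unfolding monomial_field_def
    using P that q zero by (intro list) (fastforce simp: mpoly_in_def)
  then show ?thesis
    using S by (auto simp: creation_only_on_def poly_field_def
        intro!: complex_vs.subspace_sum complex_vs.subspace_scale sum.neutral)
qed

text \<open>Closing under sums, scalars and all modes, the nonnegative ones included, gives an
  induction over states instead of words.\<close>

inductive_set mode_span :: "nat \<Rightarrow> (nat \<Rightarrow> 'v::complex_vector_space fld) \<Rightarrow> 'v \<Rightarrow> 'v set"
  for m q vac where
  vacuum: "vac \<in> mode_span m q vac"
| zero: "0 \<in> mode_span m q vac"
| add: "x \<in> mode_span m q vac \<Longrightarrow> y \<in> mode_span m q vac \<Longrightarrow> x + y \<in> mode_span m q vac"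
| scale: "x \<in> mode_span m q vac \<Longrightarrow> c *\<^sub>C x \<in> mode_span m q vac"
| mode: "x \<in> mode_span m q vac \<Longrightarrow> \<alpha> < m \<Longrightarrow> q \<alpha> n x \<in> mode_span m q vac"

lemma subspace_mode_span: "csubspace (mode_span m q vac)"
  by (auto simp: complex_vs.subspace_def intro: mode_span.intros)

text \<open>The mode of \<phi> is commuted past every mode of q until it reaches the vacuum.\<close>

lemma mode_span_annihilated:
  assumes v: "v \<in> mode_span m q vac" and linear: "clinear (\<phi> n)" "\<And>\<alpha> k. \<alpha> < m \<Longrightarrow> q \<alpha> k 0 = 0"
    and vac: "\<phi> n vac = 0" and commute: "\<And>\<alpha> k x. \<alpha> < m \<Longrightarrow> \<phi> n (q \<alpha> k x) = q \<alpha> k (\<phi> n x)"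
  shows "\<phi> n v = 0"
  using v
  by induction (auto simp: vac commute linear(2) complex_vs_pair.linear_0[OF linear(1)]
      complex_vs_pair.linear_add[OF linear(1)] complex_vs_pair.linear_scale[OF linear(1)])

text \<open>On the vacuum the product with a field in the \<open>q\<^sup>\<alpha>\<close> alone reduces to a single term, so that it is
  additive in both factors without any discussion of summability.\<close>

lemma fld_mult_on_vacuum:
  assumes \<psi>: "creation_only_on S \<psi>" "vac \<in> S" and \<phi>: "\<And>n v. n \<ge> 0 \<Longrightarrow> v \<in> S \<Longrightarrow> \<phi> n v = 0"
    "\<And>n. \<phi> n 0 = 0"
  shows "fld_mult \<phi> \<psi> (-1) vac = \<phi> (-1) (\<psi> (-1) vac)"
proof -
  \<comment> \<open>The indices add up to -2, so both are negative only for k = -1.\<close>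
  have "\<phi> k (\<psi> (- 1 - k - 1) vac) = 0" if "k \<noteq> -1" for k
    using \<psi> \<phi> that by (cases "k \<ge> 0") (auto simp: creation_only_on_def)
  then have "fld_mult \<phi> \<psi> (-1) vac = (\<Sum>k\<in>{-1}. \<phi> k (\<psi> (- 1 - k - 1) vac))"
    unfolding fld_mult_def by (intro Sum_any.expand_superset) auto
  then show ?thesis by simp
qed

section \<open>The equivariance of the currents\<close>

lemma act_superset:
  assumes "finite S" "Poly_Mapping.keys f \<subseteq> S"
  shows "act \<phi> f v = (\<Sum>u\<in>S. Poly_Mapping.lookup f u *\<^sub>C foldr (\<lambda>(s, n). \<phi> s n) u v)"
  unfolding act_def using assms by (intro sum.mono_neutral_left) (auto simp: in_keys_iff)

lemma act_zero [simp]: "act \<phi> 0 v = 0"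
  by (simp add: act_def)

lemma act_add: "act \<phi> (f + g) v = act \<phi> f v + act \<phi> g v"
proof -
  let ?S = "Poly_Mapping.keys f \<union> Poly_Mapping.keys g"
  have "finite ?S" "Poly_Mapping.keys (f + g) \<subseteq> ?S" by (simp_all add: Poly_Mapping.keys_add)
  then show ?thesis
    by (simp add: act_superset[of ?S] lookup_add complex_vs.scale_left_distrib sum.distrib)
qed

lemma act_sum: "act \<phi> (\<Sum>i\<in>I. f i) v = (\<Sum>i\<in>I. act \<phi> (f i) v)"
  by (induction I rule: infinite_finite_induct) (auto simp: act_add)

lemma act_single: "act \<phi> (Poly_Mapping.single u c) v = c *\<^sub>C foldr (\<lambda>(s, n). \<phi> s n) u v"
  by (subst act_superset[of "{u}"]) auto

lemma mode_linear:
  assumes "is_vertex_algebra V"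
  shows "clinear (mode V a n)" "clinear (\<lambda>a. mode V a n b)"
  using assms by (auto simp: is_vertex_algebra_def)

lemma mode_vacuum:
  assumes "is_vertex_algebra V"
  shows "mode V a (-1) (vacuum V) = a"
  using assms by (simp add: is_vertex_algebra_def)

lemma homogeneous_mode: "is_vertex_algebra V \<Longrightarrow> homogeneous_field (mode V a)"
  by (simp add: homogeneous_field_def complex_vs_pair.linear_scale[OF mode_linear(1)])

lemma weighted_mode:
  assumes V: "is_vertex_algebra V" and \<tau>: "va_automorphism V \<tau>" and a: "\<tau> a = c *\<^sub>C a"
  shows "weighted_field \<tau> c (mode V a)"
  using \<tau> a
  by (simp add: weighted_field_def va_automorphism_def va_hom_def
      complex_vs_pair.linear_scale[OF mode_linear(2)[OF V]])

lemma va_hom_compose: "va_hom U V f \<Longrightarrow> va_hom V W g \<Longrightarrow> va_hom U W (g \<circ> f)"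
  by (auto simp: va_hom_def Vector_Spaces.linear_iff)

lemma va_hom_eqI:
  assumes V: "va_generated V S br g" and f: "va_hom V W f" and f': "va_hom V W f'"
    and generators: "\<And>s. s \<in> S \<Longrightarrow> f (g s) = f' (g s)"
  shows "f = f'"
proof
  fix v
  let ?word = "\<lambda>u. foldr (\<lambda>(s, n). mode V (g s) n) u (vacuum V)"
  have word: "f (?word u) = f' (?word u)" if "u \<in> words S" for u
    using that
  proof (induction u)
    case Nil
    then show ?case using f f' by (simp add: va_hom_def)
  next
    case (Cons x u)
    then show ?case using f f' generators
      by (cases x) (simp add: va_hom_def words_def)
  qed
  obtain p where p: "Poly_Mapping.keys p \<subseteq> words S" "v = act (\<lambda>s. mode V (g s)) p (vacuum V)"
    using V unfolding va_generated_def vacuum_module_def by metis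
  have "f v = (\<Sum>u\<in>Poly_Mapping.keys p. Poly_Mapping.lookup p u *\<^sub>C f (?word u))" if "va_hom V W f" for f
    using that unfolding p(2) act_def va_hom_def
    by (simp add: complex_vs_pair.linear_sum complex_vs_pair.linear_scale)
  from this[OF f] this[OF f'] show "f v = f' v"
    using word p(1) by (auto intro!: sum.cong)
qed

text \<open>The level is nonzero, so the form can be recovered from the vertex algebra:
  \<open>J\<^sub>a[1] J\<^sub>b[-1] |0\<rangle> = K \<langle>T\<^sub>a, T\<^sub>b\<rangle> |0\<rangle>\<close>.\<close>

lemma affine_current_pairing:
  assumes A: "va_generated A {..<d} (affine_commutator B K d Tlo Tup) J"
    and a: "a < d" and b: "b < d"
  shows "mode A (J a) 1 (J b) = (K * B (Tlo a) (Tlo b)) *\<^sub>C vacuum A"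
proof -
  have V: "is_vertex_algebra A" and M: "vacuum_module {..<d} (affine_commutator B K d Tlo Tup)
      (\<lambda>s. mode A (J s)) (vacuum A)"
    using A by (auto simp: va_generated_def)
  have ann: "mode A (J s) n (vacuum A) = 0" if "s < d" "n \<ge> 0" for s n
    using M that by (simp add: vacuum_module_def)
  \<comment> \<open>Modes 1 and -1 leave zero modes of currents, which kill the vacuum, and the
    central term with factor 1.\<close>
  have "mode A (J a) 1 (mode A (J b) (-1) (vacuum A)) - mode A (J b) (-1) (mode A (J a) 1 (vacuum A))
      = act (\<lambda>s. mode A (J s)) (affine_commutator B K d Tlo Tup (a, 1) (b, -1)) (vacuum A)"
    using M a b unfolding vacuum_module_def by blast
  moreover have "mode A (J b) (-1) (mode A (J a) 1 (vacuum A)) = 0"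
    using ann[OF a, of 1] complex_vs_pair.linear_0[OF mode_linear(1)[OF V]] by simp
  ultimately show ?thesis
    using ann by (simp add: mode_vacuum[OF V] act_add act_sum act_single delta_deriv_term_def)
qed

text \<open>Apply \<sigma> to the pairing of two currents: the vacuum is fixed and nonzero, so the
  scalars agree, and the nonzero level cancels.\<close>

lemma affine_automorphism_form:
  assumes A: "va_generated A {..<d} (affine_commutator B K d Tlo Tup) J" and K: "K \<noteq> 0"
    and \<sigma>: "va_automorphism A \<sigma>" "\<And>a. a < d \<Longrightarrow> \<sigma> (J a) = w a *\<^sub>C J a"
    and nontrivial: "vacuum A \<noteq> 0" and a: "a < d" and b: "b < d"
  shows "w a * w b * B (Tlo a) (Tlo b) = B (Tlo a) (Tlo b)"
proof -
  have V: "is_vertex_algebra A" using A by (simp add: va_generated_def)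
  let ?c = "K * B (Tlo a) (Tlo b)"
  have \<sigma>': "clinear \<sigma>" "\<sigma> (vacuum A) = vacuum A" "\<sigma> (mode A x n y) = mode A (\<sigma> x) n (\<sigma> y)" for x n y
    using \<sigma>(1) by (auto simp: va_automorphism_def va_hom_def)
  have "?c *\<^sub>C vacuum A = \<sigma> (?c *\<^sub>C vacuum A)"
    by (simp add: complex_vs_pair.linear_scale[OF \<sigma>'(1)] \<sigma>'(2))
  also have "\<dots> = \<sigma> (mode A (J a) 1 (J b))"
    by (simp add: affine_current_pairing[OF A a b])
  also have "\<dots> = mode A (w a *\<^sub>C J a) 1 (w b *\<^sub>C J b)"
    by (simp only: \<sigma>'(3) \<sigma>(2)[OF a] \<sigma>(2)[OF b])
  also have "\<dots> = (w a * w b * ?c) *\<^sub>C vacuum A"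
    by (simp add: complex_vs_pair.linear_scale[OF mode_linear(1)[OF V]]
        complex_vs_pair.linear_scale[OF mode_linear(2)[OF V]] cscale_cscale
        affine_current_pairing[OF A a b])
  finally have "?c = w a * w b * ?c" using nontrivial by (simp add: complex_vs.scale_right_imp_eq)
  then show ?thesis using K by (simp add: field_simps)
qed

text \<open>By bilinearity basis vectors suffice, where the hypothesis says that a nonzero pairing
  forces inverse eigenvalues.\<close>

lemma diagonal_form_invariant:
  assumes form: "invariant_form B" and linear: "clinear \<tau>"
    and dual: "dual_bases B I e f UNIV UNIV" and e: "\<And>i. i \<in> I \<Longrightarrow> \<tau> (e i) = w i *\<^sub>C e i"
    and w: "\<And>i j. i \<in> I \<Longrightarrow> j \<in> I \<Longrightarrow> w i * w j * B (e i) (e j) = B (e i) (e j)"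
  shows "B (\<tau> x) (\<tau> y) = B x y"
proof -
  interpret invariant_bilinear B by unfold_locales (rule form)
  have x: "x = (\<Sum>i\<in>I. B (f i) x *\<^sub>C e i)" for x
    by (rule dual_basis_expansion[OF form dual_bases_commute[OF form dual]]) simp
  have \<tau>: "\<tau> x = (\<Sum>i\<in>I. (B (f i) x * w i) *\<^sub>C e i)" for x
    by (subst x) (simp add: complex_vs_pair.linear_sum[OF linear] complex_vs_pair.linear_scale[OF linear]
        e cscale_cscale)
  have bilinear: "B (\<Sum>i\<in>I. a i *\<^sub>C e i) (\<Sum>j\<in>I. b j *\<^sub>C e j) = (\<Sum>i\<in>I. \<Sum>j\<in>I. a i * b j * B (e i) (e j))" for a b
    unfolding form_sum_left unfolding form_sum_right by (simp add: form_scale_left form_scale_right mult_ac)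
  have "B (\<tau> x) (\<tau> y) = (\<Sum>i\<in>I. \<Sum>j\<in>I. B (f i) x * B (f j) y * (w i * w j * B (e i) (e j)))"
    unfolding \<tau> bilinear by (simp add: mult_ac)
  also have "\<dots> = (\<Sum>i\<in>I. \<Sum>j\<in>I. B (f i) x * B (f j) y * B (e i) (e j))"
    by (intro sum.cong refl) (simp add: w)
  also have "\<dots> = B (\<Sum>i\<in>I. B (f i) x *\<^sub>C e i) (\<Sum>j\<in>I. B (f j) y *\<^sub>C e j)"
    unfolding bilinear ..
  also have "\<dots> = B x y" by (simp flip: x)
  finally show ?thesis .
qed

context equivariant_form
begin

lemma coefficient_weight:
  assumes T: "dual_bases B {..<d} Tlo Tup UNIV UNIV"
    and L: "\<And>\<alpha>. \<alpha> < m \<Longrightarrow> \<tau> (L \<alpha>) = w \<alpha> *\<^sub>C L \<alpha>"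
    and P: "\<And>x. exp_ad (- neg_element m L x) X = (\<Sum>b<d. eval (P b) x *\<^sub>C Tup b)"
    and X: "\<tau> X = c *\<^sub>C X" "c \<noteq> 0" and a: "a < d" "\<tau> (Tlo a) = t *\<^sub>C Tlo a" "t \<noteq> 0"
  shows "eval (P a) (\<lambda>\<alpha>. w \<alpha> * x \<alpha>) = 1 / (c * t) * eval (P a) x"
proof -
  have "eval (P a) x = B (Tlo a) (exp_ad (- neg_element m L x) X)" for x
    unfolding P using a(1) by (intro dual_basis_coefficient[OF form T, symmetric]) simp
  then show ?thesis by (simp only: exp_ad_pairing_weight[OF L X a(2,3)])
qed

text \<open>In each summand the derivative of \<Psi> contributes
  \<open>w l / w \<gamma> / w \<alpha>\<close>, the factor \<Phi> contributes
  \<open>w \<rho> / w l\<close>, and the exponential \<open>w \<gamma> / w \<rho>\<close>. All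
  summation indices cancel, and pairing with \<open>Tlo a\<close> adds 1 / t.\<close>

lemma Lambda_weight:
  fixes L U :: "nat \<Rightarrow> 'g"
  assumes T: "dual_bases B {..<d} Tlo Tup UNIV UNIV"
    and L: "\<And>\<alpha>. \<alpha> < m \<Longrightarrow> \<tau> (L \<alpha>) = w \<alpha> *\<^sub>C L \<alpha>" and w: "\<And>\<alpha>. \<alpha> < m \<Longrightarrow> w \<alpha> \<noteq> 0"
    and U: "\<And>\<alpha>. \<alpha> < m \<Longrightarrow> \<tau> (U \<alpha>) = (1 / w \<alpha>) *\<^sub>C U \<alpha>"
    and \<Phi>: "\<And>\<alpha> \<beta> x. \<alpha> < m \<Longrightarrow> \<beta> < m \<Longrightarrow>
        eval (\<Phi> \<alpha> \<beta>) (\<lambda>\<gamma>. w \<gamma> * x \<gamma>) = w \<beta> / w \<alpha> * eval (\<Phi> \<alpha> \<beta>) x"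
    and \<Psi>: "\<And>\<alpha> \<beta> x. \<alpha> < m \<Longrightarrow> \<beta> < m \<Longrightarrow>
        eval (\<Psi> \<alpha> \<beta>) (\<lambda>\<gamma>. w \<gamma> * x \<gamma>) = w \<beta> / w \<alpha> * eval (\<Psi> \<alpha> \<beta>) x"
    and \<Lambda>: "\<And>x. (\<Sum>\<gamma><m. \<Sum>l<m. \<Sum>\<rho><m. (partial_derivative \<alpha> (eval (\<Psi> \<gamma> l)) x * eval (\<Phi> l \<rho>) x) *\<^sub>C
            exp_ad (- neg_element m L x) (lie (U \<gamma>) (L \<rho>)))
        = (\<Sum>b<d. eval (P b) x *\<^sub>C Tup b)"
    and \<alpha>: "\<alpha> < m" and a: "a < d" "\<tau> (Tlo a) = t *\<^sub>C Tlo a" "t \<noteq> 0"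
  shows "eval (P a) (\<lambda>\<gamma>. w \<gamma> * x \<gamma>) = 1 / (w \<alpha> * t) * eval (P a) x"
proof -
  let ?wx = "\<lambda>\<gamma>. w \<gamma> * x \<gamma>"
  let ?F = "\<lambda>\<gamma> l \<rho> x. (partial_derivative \<alpha> (eval (\<Psi> \<gamma> l)) x * eval (\<Phi> l \<rho>) x) *\<^sub>C
            exp_ad (- neg_element m L x) (lie (U \<gamma>) (L \<rho>))"
  have P: "eval (P a) x = B (Tlo a) (\<Sum>\<gamma><m. \<Sum>l<m. \<Sum>\<rho><m. ?F \<gamma> l \<rho> x)" for x
    unfolding \<Lambda> using a(1) by (intro dual_basis_coefficient[OF form T, symmetric]) simp
  have "?F \<gamma> l \<rho> ?wx = (1 / w \<alpha>) *\<^sub>C \<tau> (?F \<gamma> l \<rho> x)" if "\<gamma> < m" "l < m" "\<rho> < m" for \<gamma> l \<rho>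
  proof -
    have "\<tau> (lie (U \<gamma>) (L \<rho>)) = (w \<rho> / w \<gamma>) *\<^sub>C lie (U \<gamma>) (L \<rho>)"
      using that by (simp add: tau_lie L U lie_scale_left lie_scale_right cscale_cscale)
    then have "exp_ad (- neg_element m L ?wx) (lie (U \<gamma>) (L \<rho>))
        = (w \<gamma> / w \<rho>) *\<^sub>C \<tau> (exp_ad (- neg_element m L x) (lie (U \<gamma>) (L \<rho>)))"
      using that w by (subst exp_ad_weight[OF L]) auto
    moreover have "partial_derivative \<alpha> (eval (\<Psi> \<gamma> l)) ?wx
        = w l / w \<gamma> / w \<alpha> * partial_derivative \<alpha> (eval (\<Psi> \<gamma> l)) x"
      using that w \<alpha> by (intro partial_derivative_weight \<Psi>) auto
    moreover have "w l / w \<gamma> / w \<alpha> * y * (w \<rho> / w l * z) * (w \<gamma> / w \<rho>) = 1 / w \<alpha> * (y * z)" for y z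
      using that w \<alpha> by (simp add: field_simps)
    ultimately show ?thesis
      using that by (simp only: \<Phi> tau_scale cscale_cscale)
  qed
  then have "(\<Sum>\<gamma><m. \<Sum>l<m. \<Sum>\<rho><m. ?F \<gamma> l \<rho> ?wx)
      = (\<Sum>\<gamma><m. \<Sum>l<m. \<Sum>\<rho><m. (1 / w \<alpha>) *\<^sub>C \<tau> (?F \<gamma> l \<rho> x))"
    by (intro sum.cong refl) simp
  also have "\<dots> = (1 / w \<alpha>) *\<^sub>C \<tau> (\<Sum>\<gamma><m. \<Sum>l<m. \<Sum>\<rho><m. ?F \<gamma> l \<rho> x)"
    by (simp only: tau_sum complex_vs.scale_sum_right)
  finally have "eval (P a) ?wx = 1 / w \<alpha> * B (Tlo a) (\<tau> (\<Sum>\<gamma><m. \<Sum>l<m. \<Sum>\<rho><m. ?F \<gamma> l \<rho> x))"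
    by (simp only: P form_scale_right)
  moreover have "B (Tlo a) (\<tau> (\<Sum>\<gamma><m. \<Sum>l<m. \<Sum>\<rho><m. ?F \<gamma> l \<rho> x)) = 1 / t * eval (P a) x"
    using form_eigenvector[OF a(2), of "\<Sum>\<gamma><m. \<Sum>l<m. \<Sum>\<rho><m. ?F \<gamma> l \<rho> x"] a(3)
    by (simp add: P nonzero_eq_divide_eq mult.commute)
  ultimately show ?thesis by simp
qed

end

theorem proposition2:
  fixes B :: "'g::complex_lie_algebra \<Rightarrow> 'g \<Rightarrow> complex"
    and H :: 'g and \<tau> :: "'g \<Rightarrow> 'g" and N :: nat and K :: complex
    and F :: "nat \<Rightarrow> 'g set" and r :: nat
    and d m d0 :: nat and dim0 :: "nat \<Rightarrow> nat"
    and Tlo Tup L U Dklo Dkup :: "nat \<Rightarrow> 'g"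
    and Dlo Dup :: "nat \<Rightarrow> nat \<Rightarrow> 'g"
    and \<omega>Tlo \<omega>Tup \<omega>L \<omega>U \<omega>0lo \<omega>0up :: "nat \<Rightarrow> complex"
    and \<Phi> \<Psi> \<U> \<L> \<Lambda> :: "nat \<Rightarrow> nat \<Rightarrow> mpoly" and \<D> :: "nat \<Rightarrow> nat \<Rightarrow> nat \<Rightarrow> mpoly"
    and \<psi> :: 'g and h :: complex and \<psi>0 :: "nat \<Rightarrow> 'g" and h0 :: "nat \<Rightarrow> complex"
    and K0 :: "nat \<Rightarrow> complex"
    and A :: "'a::complex_vector_space vertex_algebra" and J :: "nat \<Rightarrow> 'a"
    and W :: "'w::complex_vector_space vertex_algebra" and gen :: "wgen \<Rightarrow> 'w"
    and jk :: "nat \<Rightarrow> 'w"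
    and WH :: "'a \<Rightarrow> 'w" and \<tau>A :: "'a \<Rightarrow> 'a" and \<tau>W :: "'w \<Rightarrow> 'w"
  assumes simple: "lie_simple (UNIV :: 'g set)" "finite_dimensional (UNIV :: 'g set)"
    and form: "invariant_form B"
    and gradation: "integer_gradation H"
    and factors: "grade0_factors H r F"
    and \<tau>: "lie_automorphism \<tau>" "has_order \<tau> N"
    and K: "K \<noteq> 0"
    and compatible: "\<tau> H = H"
    (* dual bases *)
    and T: "dual_bases B {..<d} Tlo Tup UNIV UNIV"
      "\<forall>a<d. joint_eigenvector H \<tau> (Tlo a) (\<omega>Tlo a) \<and> joint_eigenvector H \<tau> (Tup a) (\<omega>Tup a)"
    and LU: "dual_bases B {..<m} L U (neg_part H) (pos_part H)"
      "\<forall>\<alpha><m. joint_eigenvector H \<tau> (L \<alpha>) (\<omega>L \<alpha>) \<and> joint_eigenvector H \<tau> (U \<alpha>) (\<omega>U \<alpha>)"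
    and TL: "m \<le> d" "\<forall>\<alpha><m. Tlo \<alpha> = L \<alpha>"
    and D: "dual_bases B (SIGMA i:{..r}. {..<dim0 i}) (\<lambda>(i, \<mu>). Dlo i \<mu>) (\<lambda>(i, \<mu>). Dup i \<mu>)
        (grade H 0) (grade H 0)"
      "\<forall>i\<le>r. \<forall>\<mu><dim0 i. Dlo i \<mu> \<in> F i \<and> Dup i \<mu> \<in> F i"
    and Dk: "dual_bases B {..<d0} Dklo Dkup (grade H 0) (grade H 0)"
      "\<forall>k<d0. \<tau> (Dklo k) = \<omega>0lo k *\<^sub>C Dklo k \<and> \<tau> (Dkup k) = \<omega>0up k *\<^sub>C Dkup k"
    (* polynomials *)
    and polynomials: "\<forall>\<alpha> \<beta>. mpoly_in m (\<Phi> \<alpha> \<beta>) \<and> mpoly_in m (\<Psi> \<alpha> \<beta>)"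
      "\<forall>\<alpha> b. mpoly_in m (\<U> \<alpha> b) \<and> mpoly_in m (\<L> \<alpha> b) \<and> mpoly_in m (\<Lambda> \<alpha> b)"
      "\<forall>i \<mu> b. mpoly_in m (\<D> i \<mu> b)"
    and \<U>: "\<forall>\<alpha><m. \<forall>x. exp_ad (- neg_element m L x) (U \<alpha>) = (\<Sum>b<d. eval (\<U> \<alpha> b) x *\<^sub>C Tup b)"
    and \<L>: "\<forall>\<alpha><m. \<forall>x. exp_ad (- neg_element m L x) (L \<alpha>) = (\<Sum>b<d. eval (\<L> \<alpha> b) x *\<^sub>C Tup b)"
    and \<D>: "\<forall>i\<le>r. \<forall>\<mu><dim0 i. \<forall>x.
        exp_ad (- neg_element m L x) (Dup i \<mu>) = (\<Sum>b<d. eval (\<D> i \<mu> b) x *\<^sub>C Tup b)"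
    (* the identity (d e^q / d q^alpha) e^{-q} = Phi_alpha^beta L_beta, written in the faithful
       adjoint representation *)
    and \<Phi>: "\<forall>\<alpha><m. \<forall>x X Y.
        ((\<lambda>t. B (exp_ad (neg_element m L (x(\<alpha> := t))) (exp_ad (- neg_element m L x) X)) Y)
          has_field_derivative B (lie (\<Sum>\<beta><m. eval (\<Phi> \<alpha> \<beta>) x *\<^sub>C L \<beta>) X) Y) (at (x \<alpha>))"
    and \<Psi>: "\<forall>\<alpha><m. \<forall>\<gamma><m. \<forall>x.
        (\<Sum>\<beta><m. eval (\<Phi> \<alpha> \<beta>) x * eval (\<Psi> \<beta> \<gamma>) x) = (if \<alpha> = \<gamma> then 1 else 0)"
    and \<Lambda>: "\<forall>\<alpha><m. \<forall>x.
        (\<Sum>\<gamma><m. \<Sum>l<m. \<Sum>\<rho><m. (partial_derivative \<alpha> (eval (\<Psi> \<gamma> l)) x * eval (\<Phi> l \<rho>) x) *\<^sub>C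
            exp_ad (- neg_element m L x) (lie (U \<gamma>) (L \<rho>)))
        = (\<Sum>b<d. eval (\<Lambda> \<alpha> b) x *\<^sub>C Tup b)"
    (* levels *)
    and roots: "highest_root_and_dual_coxeter B (UNIV :: 'g set) \<psi> h"
      "\<forall>i. 1 \<le> i \<and> i \<le> r \<longrightarrow> highest_root_and_dual_coxeter B (F i) (\<psi>0 i) (h0 i)"
    and levels: "2 * K0 0 = 2 * K + B \<psi> \<psi> * h"
      "\<forall>i. 1 \<le> i \<and> i \<le> r \<longrightarrow> 2 * K0 i + B (\<psi>0 i) (\<psi>0 i) * h0 i = 2 * K + B \<psi> \<psi> * h"
    (* the vertex algebras *)
    and A: "va_generated A {..<d} (affine_commutator B K d Tlo Tup) J"
    and W: "va_generated W (wgens m r dim0) (w_commutator B K0 dim0 Dlo Dup) gen"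
    and jk: "\<forall>X. (\<Sum>i\<le>r. \<Sum>\<mu><dim0 i. B (Dup i \<mu>) X *\<^sub>C gen (Jgen i \<mu>)) = (\<Sum>k<d0. B (Dkup k) X *\<^sub>C jk k)"
    (* the Wakimoto homomorphism *)
    and WH: "va_hom A W WH"
      "\<forall>a<d. mode W (WH (J a)) = wakimoto_current m r dim0 K \<Phi> \<Psi> \<U> \<L> \<D> \<Lambda>
        (\<lambda>\<beta>. mode W (gen (Pgen \<beta>))) (\<lambda>\<alpha>. mode W (gen (Qgen \<alpha>))) (\<lambda>i \<mu>. mode W (gen (Jgen i \<mu>))) a"
    (* the automorphisms *)
    and \<tau>A: "va_automorphism A \<tau>A" "\<forall>a<d. \<tau>A (J a) = \<omega>Tlo a *\<^sub>C J a"
    and \<tau>W: "va_automorphism W \<tau>W"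
      "\<forall>\<alpha><m. \<tau>W (gen (Pgen \<alpha>)) = \<omega>L \<alpha> *\<^sub>C gen (Pgen \<alpha>) \<and> \<tau>W (gen (Qgen \<alpha>)) = \<omega>U \<alpha> *\<^sub>C gen (Qgen \<alpha>)"
      "\<forall>k<d0. \<tau>W (jk k) = \<omega>0lo k *\<^sub>C jk k"
  shows "\<tau>W \<circ> WH = WH \<circ> \<tau>A"
proof (cases "vacuum A = 0")
  \<comment> \<open>The form cannot be read off from the zero vertex algebra, so this case is
    separated. Each state is its mode -1 on the vacuum, hence 0.\<close>
  case True
  have "is_vertex_algebra A" using A by (simp add: va_generated_def)
  then have "x = 0" for x :: 'a
    using mode_vacuum[of A x] complex_vs_pair.linear_0[OF mode_linear(1)[of A x "-1"]] True by simp
  then have "\<tau>A x = 0" "x = 0" for x by auto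
  moreover have "WH 0 = 0" "\<tau>W 0 = 0"
    using WH(1) \<tau>W(1) by (auto simp: va_hom_def va_automorphism_def complex_vs_pair.linear_0)
  ultimately show ?thesis by (metis comp_apply ext)
next
  case False
  have V: "is_vertex_algebra W" and M: "vacuum_module (wgens m r dim0) (w_commutator B K0 dim0 Dlo Dup)
      (\<lambda>s. mode W (gen s)) (vacuum W)"
    using W by (auto simp: va_generated_def)

  \<comment> \<open>Eigenvalues of the dual bases\<close>
  have lin_\<tau>: "clinear \<tau>" using \<tau>(1) by (simp add: lie_automorphism_def)
  have eigen: "\<tau> (L \<alpha>) = \<omega>L \<alpha> *\<^sub>C L \<alpha>" "\<tau> (U \<alpha>) = \<omega>U \<alpha> *\<^sub>C U \<alpha>" if "\<alpha> < m" for \<alpha>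
    using LU(2) that by (auto simp: joint_eigenvector_def)
  have eigen_T: "\<tau> (Tlo a) = \<omega>Tlo a *\<^sub>C Tlo a" "\<tau> (Tup a) = \<omega>Tup a *\<^sub>C Tup a" if "a < d" for a
    using T(2) that by (auto simp: joint_eigenvector_def)
  have eigen_D: "\<tau> (Dklo k) = \<omega>0lo k *\<^sub>C Dklo k" "\<tau> (Dkup k) = \<omega>0up k *\<^sub>C Dkup k" if "k < d0" for k
    using Dk(2) that by auto
  have form_\<tau>: "B (\<tau> x) (\<tau> y) = B x y" for x y
    using affine_automorphism_form[OF A K \<tau>A(1), of \<omega>Tlo] \<tau>A(2) False
    by (intro diagonal_form_invariant[OF form lin_\<tau> T(1), of \<omega>Tlo]) (auto simp: eigen_T)
  interpret G: equivariant_form B \<tau>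
    by unfold_locales (use form \<tau>(1) form_\<tau> in auto)
  have \<omega>LU: "\<omega>L \<alpha> * \<omega>U \<alpha> = 1" if "\<alpha> < m" for \<alpha>
    using that LU(1) by (intro G.dual_eigenvalues[OF eigen]) (auto simp: dual_bases_def)
  have \<omega>T: "\<omega>Tlo a * \<omega>Tup a = 1" if "a < d" for a
    using that T(1) by (intro G.dual_eigenvalues[OF eigen_T]) (auto simp: dual_bases_def)
  have \<omega>0: "\<omega>0lo k * \<omega>0up k = 1" if "k < d0" for k
    using that Dk(1) by (intro G.dual_eigenvalues[OF eigen_D]) (auto simp: dual_bases_def)
  have nz: "\<alpha> < m \<Longrightarrow> \<omega>L \<alpha> \<noteq> 0" "\<alpha> < m \<Longrightarrow> \<omega>U \<alpha> \<noteq> 0" "a < d \<Longrightarrow> \<omega>Tlo a \<noteq> 0" "k < d0 \<Longrightarrow> \<omega>0up k \<noteq> 0"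
    for \<alpha> a k
    using \<omega>LU[of \<alpha>] \<omega>T[of a] \<omega>0[of k] by auto
  have \<omega>U: "\<omega>U \<alpha> = 1 / \<omega>L \<alpha>" if "\<alpha> < m" for \<alpha>
    using \<omega>LU[OF that] nz(1)[OF that] by (simp add: nonzero_eq_divide_eq mult.commute)

  \<comment> \<open>Weights of the polynomials\<close>
  have \<Phi>_weight: "eval (\<Phi> \<alpha> \<beta>) (\<lambda>\<gamma>. \<omega>L \<gamma> * x \<gamma>) = \<omega>L \<beta> / \<omega>L \<alpha> * eval (\<Phi> \<alpha> \<beta>) x"
    if "\<alpha> < m" "\<beta> < m" for \<alpha> \<beta> x
    using \<Phi> eigen(1) nz(1) that
    by (intro G.Phi_weight[OF simple(1) LU(1), where \<phi> = "\<lambda>\<alpha> \<beta>. eval (\<Phi> \<alpha> \<beta>)"]) blast+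
  have \<Psi>_weight: "eval (\<Psi> \<alpha> \<beta>) (\<lambda>\<gamma>. \<omega>L \<gamma> * x \<gamma>) = \<omega>L \<beta> / \<omega>L \<alpha> * eval (\<Psi> \<alpha> \<beta>) x"
    if "\<alpha> < m" "\<beta> < m" for \<alpha> \<beta> x
    using \<Psi> nz(1) that
    by (intro Psi_weight[where \<phi> = "\<lambda>\<alpha> \<beta>. eval (\<Phi> \<alpha> \<beta>)" and \<psi> = "\<lambda>\<alpha> \<beta>. eval (\<Psi> \<alpha> \<beta>)", OF \<Phi>_weight])
      blast+
  have \<U>_weight: "eval (\<U> \<alpha> a) (\<lambda>\<gamma>. \<omega>L \<gamma> * x \<gamma>) = 1 / (\<omega>U \<alpha> * \<omega>Tlo a) * eval (\<U> \<alpha> a) x"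
    if "\<alpha> < m" "a < d" for \<alpha> a x
    using that
    by (intro G.coefficient_weight[OF T(1) eigen(1) \<U>[rule_format, OF that(1)] eigen(2)]) (simp_all add: eigen_T nz)
  have \<L>_weight: "eval (\<L> \<alpha> a) (\<lambda>\<gamma>. \<omega>L \<gamma> * x \<gamma>) = 1 / (\<omega>L \<alpha> * \<omega>Tlo a) * eval (\<L> \<alpha> a) x"
    if "\<alpha> < m" "a < d" for \<alpha> a x
    using that
    by (intro G.coefficient_weight[OF T(1) eigen(1) \<L>[rule_format, OF that(1)] eigen(1)]) (simp_all add: eigen_T nz)
  have \<Lambda>_weight: "eval (\<Lambda> \<alpha> a) (\<lambda>\<gamma>. \<omega>L \<gamma> * x \<gamma>) = 1 / (\<omega>L \<alpha> * \<omega>Tlo a) * eval (\<Lambda> \<alpha> a) x"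
    if "\<alpha> < m" "a < d" for \<alpha> a x
  proof (rule G.Lambda_weight[OF T(1) eigen(1) nz(1)])
    show "\<tau> (U \<alpha>) = (1 / \<omega>L \<alpha>) *\<^sub>C U \<alpha>" if "\<alpha> < m" for \<alpha>
      using eigen(2)[OF that] by (simp only: \<omega>U[OF that])
    show "(\<Sum>\<gamma><m. \<Sum>l<m. \<Sum>\<rho><m. (partial_derivative \<alpha> (eval (\<Psi> \<gamma> l)) x * eval (\<Phi> l \<rho>) x) *\<^sub>C
            exp_ad (- neg_element m L x) (lie (U \<gamma>) (L \<rho>)))
        = (\<Sum>b<d. eval (\<Lambda> \<alpha> b) x *\<^sub>C Tup b)" for x
      using \<Lambda> that(1) by blast
  qed (use that \<Phi>_weight \<Psi>_weight eigen_T nz in auto)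
  \<comment> \<open>Needed for additivity of the exponential, when \<open>Dkup k\<close> is expanded
    in the basis \<open>Dup i \<mu>\<close>.\<close>
  have nilpotent: "\<exists>n. \<forall>k\<ge>n. (lie (- neg_element m L x) ^^ k) y = 0" for x y
  proof -
    have "- neg_element m L x \<in> neg_part H"
      using LU(1) unfolding neg_element_def dual_bases_def neg_part_def
      by (intro complex_vs.span_neg complex_vs.span_sum complex_vs.span_scale)
        (metis complex_vs.span_superset imageI subsetD)
    from G.neg_part_nilpotent[OF T(1) _ gradation this, of y] show ?thesis
      using T(2) by (metis joint_eigenvector_def lessThan_iff)
  qed

  \<comment> \<open>Weights of the free fields\<close>
  define q where "q \<alpha> = mode W (gen (Qgen \<alpha>))" for \<alpha>
  define p where "p \<alpha> = mode W (gen (Pgen \<alpha>))" for \<alpha>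
  interpret I: injective_linear \<tau>W
    using \<tau>W(1) by (intro injective_linear.intro) (auto simp: va_automorphism_def va_hom_def bij_def)
  have hom: "homogeneous_field (q \<alpha>)" "homogeneous_field (p \<alpha>)" for \<alpha>
    using homogeneous_mode[OF V] by (simp_all add: q_def p_def)
  have weight_q: "weighted_field \<tau>W (\<omega>U \<alpha>) (q \<alpha>)" and weight_p: "weighted_field \<tau>W (\<omega>L \<alpha>) (p \<alpha>)"
    if "\<alpha> < m" for \<alpha>
    using \<tau>W(2) that unfolding q_def p_def by (auto intro: weighted_mode[OF V \<tau>W(1)])
  have homogeneous_poly: "homogeneous_field (poly_field q P)" if "mpoly_in m P" for P
    using that hom(1) by (rule homogeneous_poly_field)
  have weighted_poly: "weighted_field \<tau>W (1 / b) (poly_field q P)"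
    if "mpoly_in m P" "\<And>x. eval P (\<lambda>\<alpha>. \<omega>L \<alpha> * x \<alpha>) = b * eval P x" for P b
    using that(1) hom(1) weight_q \<omega>LU that(2) by (rule I.weighted_poly_field)
  have poly: "mpoly_in m (\<Phi> \<alpha> \<beta>)" "mpoly_in m (\<Psi> \<alpha> \<beta>)" "mpoly_in m (\<U> \<alpha> b)" "mpoly_in m (\<L> \<alpha> b)"
    "mpoly_in m (\<Lambda> \<alpha> b)" "mpoly_in m (\<D> i \<mu> b)" for \<alpha> \<beta> b i \<mu>
    using polynomials by auto
  have \<tau>W_vac: "\<tau>W (vacuum W) = vacuum W" using \<tau>W(1) by (simp add: va_automorphism_def va_hom_def)

  have current: "\<tau>W (WH (J a)) = \<omega>Tlo a *\<^sub>C WH (J a)" if a: "a < d" for a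
  proof -
    have p_term: "weighted_field \<tau>W (\<omega>Tlo a) (\<lambda>n v. \<Sum>\<beta><m. normal_ordered (p \<beta>)
        (\<lambda>n v. \<Sum>\<alpha><m. fld_mult (poly_field q (\<Psi> \<alpha> \<beta>)) (poly_field q (\<U> \<alpha> a)) n v) n v)"
    proof (rule I.weighted_sum_field)
      fix \<beta> assume "\<beta> \<in> {..<m}"
      then have \<beta>: "\<beta> < m" by simp
      \<comment> \<open>The eigenvalues of index \<alpha> cancel since
        \<open>\<omega>L \<alpha> * \<omega>U \<alpha> = 1\<close>; the remaining denominator is
        absorbed by \<open>p \<beta>\<close>.\<close>
      have "weighted_field \<tau>W (\<omega>Tlo a / \<omega>L \<beta>) (fld_mult (poly_field q (\<Psi> \<alpha> \<beta>)) (poly_field q (\<U> \<alpha> a)))"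
        if "\<alpha> < m" for \<alpha>
        using I.weighted_fld_mult[OF homogeneous_poly[OF poly(2)]
            weighted_poly[OF poly(2) \<Psi>_weight[OF that \<beta>]] weighted_poly[OF poly(3) \<U>_weight[OF that a]]]
          \<omega>U[OF that] nz(1)[OF that] by simp
      then have "weighted_field \<tau>W (\<omega>L \<beta> * (\<omega>Tlo a / \<omega>L \<beta>)) (normal_ordered (p \<beta>)
        (\<lambda>n v. \<Sum>\<alpha><m. fld_mult (poly_field q (\<Psi> \<alpha> \<beta>)) (poly_field q (\<U> \<alpha> a)) n v))"
        using \<beta> by (intro I.weighted_normal_ordered I.weighted_sum_field homogeneous_sum_field
            homogeneous_fld_mult homogeneous_poly poly weight_p hom) auto
      then show "weighted_field \<tau>W (\<omega>Tlo a) (\<lambda>n v. normal_ordered (p \<beta>)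
        (\<lambda>n v. \<Sum>\<alpha><m. fld_mult (poly_field q (\<Psi> \<alpha> \<beta>)) (poly_field q (\<U> \<alpha> a)) n v) n v)"
        using nz(1)[OF \<beta>] by simp
    qed

    have q_term: "weighted_field \<tau>W (\<omega>Tlo a) (\<lambda>n v. \<Sum>\<alpha><m. fld_mult
          (\<lambda>n v. K *\<^sub>C (\<Sum>\<beta><m. fld_mult (poly_field q (\<Phi> \<alpha> \<beta>)) (poly_field q (\<L> \<beta> a)) n v)
                 + poly_field q (\<Lambda> \<alpha> a) n v)
          (fld_deriv (q \<alpha>)) n v)"
    proof (rule I.weighted_sum_field)
      fix \<alpha> assume "\<alpha> \<in> {..<m}"
      then have \<alpha>: "\<alpha> < m" by simp
      \<comment> \<open>Here the eigenvalues of index \<beta> cancel, and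
        \<open>\<omega>L \<alpha>\<close> is absorbed by the derivative of
        \<open>q \<alpha>\<close>.\<close>
      have "weighted_field \<tau>W (\<omega>L \<alpha> * \<omega>Tlo a) (fld_mult (poly_field q (\<Phi> \<alpha> \<beta>)) (poly_field q (\<L> \<beta> a)))"
        if "\<beta> < m" for \<beta>
        using I.weighted_fld_mult[OF homogeneous_poly[OF poly(1)]
            weighted_poly[OF poly(1) \<Phi>_weight[OF \<alpha> that]] weighted_poly[OF poly(4) \<L>_weight[OF that a]]]
          nz(1)[OF that] by simp
      moreover have "weighted_field \<tau>W (\<omega>L \<alpha> * \<omega>Tlo a) (poly_field q (\<Lambda> \<alpha> a))"
        using weighted_poly[OF poly(5) \<Lambda>_weight[OF \<alpha> a]] by simp
      ultimately have coefficient: "weighted_field \<tau>W (\<omega>L \<alpha> * \<omega>Tlo a)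
          (\<lambda>n v. K *\<^sub>C (\<Sum>\<beta><m. fld_mult (poly_field q (\<Phi> \<alpha> \<beta>)) (poly_field q (\<L> \<beta> a)) n v)
                 + poly_field q (\<Lambda> \<alpha> a) n v)"
        by (intro I.weighted_add_field I.weighted_cscale_field I.weighted_sum_field) auto
      have "weighted_field \<tau>W (\<omega>L \<alpha> * \<omega>Tlo a * \<omega>U \<alpha>) (fld_mult
          (\<lambda>n v. K *\<^sub>C (\<Sum>\<beta><m. fld_mult (poly_field q (\<Phi> \<alpha> \<beta>)) (poly_field q (\<L> \<beta> a)) n v)
                 + poly_field q (\<Lambda> \<alpha> a) n v) (fld_deriv (q \<alpha>)))"
        by (intro I.weighted_fld_mult coefficient I.weighted_fld_deriv weight_q \<alpha> homogeneous_add_field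
            homogeneous_cscale_field homogeneous_sum_field homogeneous_fld_mult homogeneous_poly poly)
      then show "weighted_field \<tau>W (\<omega>Tlo a) (\<lambda>n v. fld_mult
          (\<lambda>n v. K *\<^sub>C (\<Sum>\<beta><m. fld_mult (poly_field q (\<Phi> \<alpha> \<beta>)) (poly_field q (\<L> \<beta> a)) n v)
                 + poly_field q (\<Lambda> \<alpha> a) n v) (fld_deriv (q \<alpha>)) n v)"
        using \<omega>U[OF \<alpha>] nz(1)[OF \<alpha>] by simp
    qed

    \<comment> \<open>The grade-zero term on the vacuum\<close>
    define X where "X i \<mu> = poly_field q (\<D> i \<mu> a) (-1) (vacuum W)" for i \<mu>
    define T2 where "T2 = (\<Sum>i\<le>r. \<Sum>\<mu><dim0 i.
        fld_mult (mode W (gen (Jgen i \<mu>))) (poly_field q (\<D> i \<mu> a)) (-1) (vacuum W))"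
    define I0 where "I0 = (SIGMA i:{..r}. {..<dim0 i})"
    have j_term: "\<tau>W T2 = \<omega>Tlo a *\<^sub>C T2"
    proof -
      define S where "S = mode_span m q (vacuum W)"
      have lin_W: "clinear (mode W x n)" for x n using mode_linear(1)[OF V] .
      note zero_W = complex_vs_pair.linear_0[OF lin_W]
      \<comment> \<open>Covers the fields q and j, which commute with every q; the fields p do
        not.\<close>
      have annihilated: "mode W (gen s) n v = 0"
        if s: "s \<in> wgens m r dim0" and com: "\<And>\<alpha> k. w_commutator B K0 dim0 Dlo Dup (s, n) (Qgen \<alpha>, k) = 0"
          and "n \<ge> 0" "v \<in> S" for s n v
      proof (rule mode_span_annihilated[where \<phi> = "mode W (gen s)" and m = m and q = q and vac = "vacuum W"])
        show "mode W (gen s) n (q \<alpha> k x) = q \<alpha> k (mode W (gen s) n x)" if "\<alpha> < m" for \<alpha> k x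
        proof -
          have "Qgen \<alpha> \<in> wgens m r dim0" using that by (simp add: wgens_def)
          then have "mode W (gen s) n (q \<alpha> k x) - q \<alpha> k (mode W (gen s) n x)
              = act (\<lambda>s. mode W (gen s)) (w_commutator B K0 dim0 Dlo Dup (s, n) (Qgen \<alpha>, k)) x"
            using M s unfolding vacuum_module_def q_def by blast
          then show ?thesis by (simp add: com)
        qed
      qed (use M that in \<open>auto simp: S_def q_def lin_W zero_W vacuum_module_def\<close>)
      have sub_S: "csubspace S" and vac_S: "vacuum W \<in> S"
        by (auto simp: S_def subspace_mode_span mode_span.vacuum)
      have "creation_only_on S (q \<alpha>)" if \<alpha>: "\<alpha> < m" for \<alpha>
      proof -
        have "q \<alpha> n v = 0" if "n \<ge> 0" "v \<in> S" for n v
          using annihilated[of "Qgen \<alpha>" n v] \<alpha> that by (simp add: q_def wgens_def)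
        moreover have "q \<alpha> n v \<in> S" if "v \<in> S" for n v
          using that \<alpha> unfolding S_def by (rule mode_span.mode)
        ultimately show ?thesis by (simp add: creation_only_on_def)
      qed
      then have creation: "creation_only_on S (poly_field q (\<D> i \<mu> a))" for i \<mu>
        by (intro creation_only_poly_field[OF sub_S poly(6)]) (auto simp: q_def zero_W)
      have "mode W (gen (Jgen i \<mu>)) n v = 0" if "i \<le> r" "\<mu> < dim0 i" "n \<ge> 0" "v \<in> S" for i \<mu> n v
        using that by (intro annihilated) (auto simp: wgens_def)
      then have "T2 = (\<Sum>i\<le>r. \<Sum>\<mu><dim0 i. mode W (gen (Jgen i \<mu>)) (-1) (X i \<mu>))"
        unfolding T2_def X_def
        by (intro sum.cong refl fld_mult_on_vacuum[OF creation vac_S]) (auto simp: zero_W)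
      also have "\<dots> = (\<Sum>(i, \<mu>)\<in>I0. mode W (gen (Jgen i \<mu>)) (-1) (X i \<mu>))"
        by (simp add: I0_def sum.Sigma)
      also have "\<dots> = (\<Sum>(i, \<mu>)\<in>I0. mode W (\<Sum>k<d0. B (Dkup k) (Dlo i \<mu>) *\<^sub>C jk k) (-1) (X i \<mu>))"
      proof (intro sum.cong refl, clarify)
        fix i \<mu> assume i: "(i, \<mu>) \<in> I0"
        \<comment> \<open>The defining identity of \<open>jk\<close>, paired with
          \<open>Dlo i \<mu>\<close>, isolates one generator by duality.\<close>
        have "(\<Sum>k<d0. B (Dkup k) (Dlo i \<mu>) *\<^sub>C jk k) =
            (\<Sum>(j, \<nu>)\<in>I0. B (Dup j \<nu>) (Dlo i \<mu>) *\<^sub>C gen (Jgen j \<nu>))"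
          using jk by (simp add: I0_def sum.Sigma)
        also have "\<dots> = (\<Sum>x\<in>I0. if x = (i, \<mu>) then gen (Jgen i \<mu>) else 0)"
        proof (intro sum.cong refl, clarify)
          fix j \<nu> assume j: "(j, \<nu>) \<in> I0"
          have "B (Dup j \<nu>) (Dlo i \<mu>) = (if (j, \<nu>) = (i, \<mu>) then 1 else 0)"
            using dual_bases_commute[OF form D(1)] i j unfolding dual_bases_def I0_def by fastforce
          then show "B (Dup j \<nu>) (Dlo i \<mu>) *\<^sub>C gen (Jgen j \<nu>) = (if (j, \<nu>) = (i, \<mu>) then gen (Jgen i \<mu>) else 0)"
            by simp
        qed
        also have "\<dots> = gen (Jgen i \<mu>)" using i by (simp add: I0_def)
        finally show "mode W (gen (Jgen i \<mu>)) (-1) (X i \<mu>)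
            = mode W (\<Sum>k<d0. B (Dkup k) (Dlo i \<mu>) *\<^sub>C jk k) (-1) (X i \<mu>)" by simp
      qed
      also have "\<dots> = (\<Sum>(i, \<mu>)\<in>I0. \<Sum>k<d0. mode W (jk k) (-1) (B (Dkup k) (Dlo i \<mu>) *\<^sub>C X i \<mu>))"
        by (simp add: complex_vs_pair.linear_sum[OF mode_linear(2)[OF V]]
            complex_vs_pair.linear_scale[OF mode_linear(2)[OF V]]
            complex_vs_pair.linear_scale[OF lin_W])
      also have "\<dots> = (\<Sum>k<d0. mode W (jk k) (-1) (\<Sum>(i, \<mu>)\<in>I0. B (Dkup k) (Dlo i \<mu>) *\<^sub>C X i \<mu>))"
        unfolding case_prod_beta by (subst sum.swap) (simp add: complex_vs_pair.linear_sum[OF lin_W])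
      \<comment> \<open>The argument of \<open>jk k\<close> is now the state of one coefficient of
        the exponential applied to the eigenvector \<open>Dkup k\<close>; unlike the single
        \<open>X i \<mu>\<close>, it has a definite weight.\<close>
      finally have T2: "T2 = (\<Sum>k<d0. mode W (jk k) (-1) (\<Sum>(i, \<mu>)\<in>I0. B (Dkup k) (Dlo i \<mu>) *\<^sub>C X i \<mu>))" .
      have "\<tau>W (mode W (jk k) (-1) (\<Sum>(i, \<mu>)\<in>I0. B (Dkup k) (Dlo i \<mu>) *\<^sub>C X i \<mu>))
          = \<omega>Tlo a *\<^sub>C mode W (jk k) (-1) (\<Sum>(i, \<mu>)\<in>I0. B (Dkup k) (Dlo i \<mu>) *\<^sub>C X i \<mu>)"
        if k: "k < d0" for k
      proof -
        have expand: "(\<Sum>x\<in>I0. B (Dkup k) (Dlo (fst x) (snd x)) * eval (\<D> (fst x) (snd x) a) y)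
            = B (Tlo a) (exp_ad (- neg_element m L y) (Dkup k))" for y
        proof -
          have "Dkup k \<in> cspan (Dkup ` {..<d0})"
            using k by (intro complex_vs.span_base) simp
          then have "Dkup k \<in> grade H 0" using Dk(1) by (simp add: dual_bases_def)
          from dual_basis_expansion[OF form D(1) this]
          have "Dkup k = (\<Sum>x\<in>I0. B (Dkup k) (Dlo (fst x) (snd x)) *\<^sub>C Dup (fst x) (snd x))"
            unfolding I0_def case_prod_beta G.form_commute[of "Dkup k"] .
          then have "exp_ad (- neg_element m L y) (Dkup k)
              = exp_ad (- neg_element m L y) (\<Sum>x\<in>I0. B (Dkup k) (Dlo (fst x) (snd x)) *\<^sub>C Dup (fst x) (snd x))"
            by (rule arg_cong)
          also have "\<dots> = (\<Sum>x\<in>I0. B (Dkup k) (Dlo (fst x) (snd x)) *\<^sub>C exp_ad (- neg_element m L y) (Dup (fst x) (snd x)))"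
            by (rule exp_ad_sum[OF nilpotent])
          finally have "exp_ad (- neg_element m L y) (Dkup k)
              = (\<Sum>x\<in>I0. B (Dkup k) (Dlo (fst x) (snd x)) *\<^sub>C exp_ad (- neg_element m L y) (Dup (fst x) (snd x)))" .
          moreover have "B (Tlo a) (exp_ad (- neg_element m L y) (Dup i \<mu>)) = eval (\<D> i \<mu> a) y"
            if "(i, \<mu>) \<in> I0" for i \<mu>
            using \<D> that a by (auto simp: I0_def intro!: dual_basis_coefficient[OF form T(1)])
          ultimately show ?thesis
            by (auto simp: G.form_sum_right G.form_scale_right intro!: sum.cong)
        qed
        \<comment> \<open>The inner fraction is the multiplier of the polynomial; the weight of the
          field is its inverse.\<close>
        have "weighted_field \<tau>W (1 / (1 / (\<omega>0up k * \<omega>Tlo a)))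
            (\<lambda>n v. \<Sum>x\<in>I0. B (Dkup k) (Dlo (fst x) (snd x)) *\<^sub>C poly_field q (\<D> (fst x) (snd x) a) n v)"
        proof (rule I.weighted_poly_combination[OF _ poly(6) hom(1) weight_q \<omega>LU])
          fix y
          show "(\<Sum>x\<in>I0. B (Dkup k) (Dlo (fst x) (snd x)) * eval (\<D> (fst x) (snd x) a) (\<lambda>\<alpha>. \<omega>L \<alpha> * y \<alpha>))
            = 1 / (\<omega>0up k * \<omega>Tlo a) * (\<Sum>x\<in>I0. B (Dkup k) (Dlo (fst x) (snd x)) * eval (\<D> (fst x) (snd x) a) y)"
            unfolding expand using k a
            by (intro G.exp_ad_pairing_weight eigen eigen_D eigen_T nz)
        qed (auto simp: I0_def)
        from weighted_fieldD[OF this, of "-1" "vacuum W"]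
        have X: "\<tau>W (\<Sum>(i, \<mu>)\<in>I0. B (Dkup k) (Dlo i \<mu>) *\<^sub>C X i \<mu>)
            = (\<omega>0up k * \<omega>Tlo a) *\<^sub>C (\<Sum>(i, \<mu>)\<in>I0. B (Dkup k) (Dlo i \<mu>) *\<^sub>C X i \<mu>)"
          by (simp add: X_def case_prod_beta \<tau>W_vac)
        have "weighted_field \<tau>W (\<omega>0lo k) (mode W (jk k))"
          using \<tau>W(3) k by (intro weighted_mode[OF V \<tau>W(1)]) simp
        \<comment> \<open>The eigenvalue of \<open>jk k\<close> cancels that of the dual vector
          \<open>Dkup k\<close>, so the weight left does not depend on k.\<close>
        moreover have "\<omega>0lo k * (\<omega>0up k * \<omega>Tlo a) = \<omega>Tlo a"
          using \<omega>0[OF k] by (simp flip: mult.assoc)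
        ultimately show ?thesis
          by (simp only: weighted_fieldD X complex_vs_pair.linear_scale[OF lin_W] cscale_cscale)
      qed
      then show ?thesis
        unfolding T2 by (simp add: I.tau_simps complex_vs.scale_sum_right)
    qed

    have "WH (J a) = wakimoto_current m r dim0 K \<Phi> \<Psi> \<U> \<L> \<D> \<Lambda> p q
        (\<lambda>i \<mu>. mode W (gen (Jgen i \<mu>))) a (-1) (vacuum W)"
      using WH(2) a mode_vacuum[OF V, of "WH (J a)"] by (simp add: p_def[abs_def] q_def[abs_def])
    then show ?thesis
      using weighted_fieldD[OF p_term, of "-1" "vacuum W"] weighted_fieldD[OF q_term, of "-1" "vacuum W"] j_term
      by (simp only: wakimoto_current_def T2_def I.tau_simps(3,4,5) \<tau>W_vac
          complex_vs.scale_right_distrib complex_vs.scale_minus_right)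
  qed

  show ?thesis
  proof (rule va_hom_eqI[OF A])
    show "va_hom A W (\<tau>W \<circ> WH)" "va_hom A W (WH \<circ> \<tau>A)"
      using WH(1) \<tau>W(1) \<tau>A(1) by (auto simp: va_automorphism_def intro: va_hom_compose)
    fix a assume "a \<in> {..<d}"
    then show "(\<tau>W \<circ> WH) (J a) = (WH \<circ> \<tau>A) (J a)"
      using current \<tau>A(2) WH(1) by (simp add: va_hom_def complex_vs_pair.linear_scale)
  qed
qed

end
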